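(* Let $p$ be an odd prime and $q=p^f$ with $f\ge 2$. Let $\chi$ and $\chi'$ be multiplicative characters on $\mathbb{F}_q^\times$, with $\chi$ of order $(q-1)/2$. If $G(\chi)=G(\chi')$, then $\chi$ and $\chi'$ are Frobenius-conjugate.
   Context: Let $\mu_n$ denote the group of $n$-th roots of unity. Fix a generator $\zeta_p$ of $\mu_p$ and the additive character $\psi:\mathbb{F}_q\to\mu_p$, $\psi(a)=\zeta_p^{\operatorname{Tr}(a)}$, where $\operatorname{Tr}:\mathbb{F}_q\to\mathbb{F}_p$ is the trace. The Gauss sum of a multiplicative character $\chi:\mathbb{F}_q^\times\to\mu_{q-1}$ is $G(\chi)=\sum_{a\in\mathbb{F}_q^\times}\chi(a)\psi(a)\in\mathbb{Z}[\mu_{q-1},\mu_p]$. Two characters $\chi,\chi'$ are Frobenius-conjugate if $\chi'(a)=\chi(\sigma(a))$ for some $\sigma\in\operatorname{Gal}(\mathbb{F}_q/\mathbb{F}_p)$, i.e. $\chi'=\chi^{p^j}$ for some integer $j\ge 0$. *)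

theory Defs
  imports
    Complex_Main
    "HOL-Library.Cardinality"
    "HOL-Computational_Algebra.Computational_Algebra"
    "HOL-Number_Theory.Cong"
begin

definition roots_of_unity :: "nat \<Rightarrow> complex set" where
  "roots_of_unity n = {z. z ^ n = 1}"

text \<open>
  The finite field \<open>F\<^sub>q\<close> is a type of class finite_field; its prime subfield \<open>F\<^sub>p\<close> is the image
  of the natural numbers.
\<close>

definition prime_subfield :: "'a :: finite_field set" where
  "prime_subfield = range of_nat"

definition galois_group :: "('a :: finite_field \<Rightarrow> 'a) set" where
  "galois_group = {\<sigma>. bij \<sigma> \<and> (\<forall>x y. \<sigma> (x + y) = \<sigma> x + \<sigma> y) \<and>
                      (\<forall>x y. \<sigma> (x * y) = \<sigma> x * \<sigma> y) \<and>
                      (\<forall>x\<in>prime_subfield. \<sigma> x = x)}"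

text \<open>The trace is an element of \<open>F\<^sub>q\<close> that lies in \<open>F\<^sub>p\<close>; see field_trace_in_prime_subfield.\<close>

definition field_trace :: "'a :: finite_field \<Rightarrow> 'a" where
  "field_trace a = (\<Sum>\<sigma>\<in>galois_group. \<sigma> a)"

definition prime_subfield_rep :: "'a :: finite_field \<Rightarrow> nat" where
  "prime_subfield_rep x = (THE n. n < CHAR('a) \<and> of_nat n = x)"

definition additive_char :: "complex \<Rightarrow> 'a :: finite_field \<Rightarrow> complex" where
  "additive_char \<zeta> a = \<zeta> ^ prime_subfield_rep (field_trace a)"

text \<open>
  A multiplicative character is a total function whose value at 0 is arbitrary: every notion
  below depends only on its values at nonzero elements.
\<close>

definition mult_char :: "('a :: finite_field \<Rightarrow> complex) \<Rightarrow> bool" where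
  "mult_char \<chi> \<longleftrightarrow>
     (\<forall>a. a \<noteq> 0 \<longrightarrow> \<chi> a \<in> roots_of_unity (CARD('a) - 1)) \<and>
     (\<forall>a b. a \<noteq> 0 \<longrightarrow> b \<noteq> 0 \<longrightarrow> \<chi> (a * b) = \<chi> a * \<chi> b)"

definition mult_char_order :: "('a :: finite_field \<Rightarrow> complex) \<Rightarrow> nat" where
  "mult_char_order \<chi> = (LEAST n. n > 0 \<and> (\<forall>a. a \<noteq> 0 \<longrightarrow> \<chi> a ^ n = 1))"

definition gauss_sum :: "complex \<Rightarrow> ('a :: finite_field \<Rightarrow> complex) \<Rightarrow> complex" where
  "gauss_sum \<zeta> \<chi> = (\<Sum>a\<in>UNIV - {0}. \<chi> a * additive_char \<zeta> a)"

definition frobenius_conjugate ::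
    "('a :: finite_field \<Rightarrow> complex) \<Rightarrow> ('a \<Rightarrow> complex) \<Rightarrow> bool" where
  "frobenius_conjugate \<chi> \<chi>' \<longleftrightarrow> (\<exists>\<sigma>\<in>galois_group. \<forall>a. a \<noteq> 0 \<longrightarrow> \<chi>' a = \<chi> (\<sigma> a))"


text \<open>The trace takes values in the prime subfield, so the exponent of \<open>\<zeta>\<close> is well defined.\<close>

lemma of_nat_mod_CHAR: "of_nat (n mod CHAR('a)) = (of_nat n :: 'a :: finite_field)"
  by (subst of_nat_eq_iff_cong_CHAR) (simp add: cong_def)

lemma prime_subfield_eq_image: "(prime_subfield :: 'a :: finite_field set) = of_nat ` {..<CHAR('a)}"
proof -
  have "(of_nat n :: 'a) \<in> of_nat ` {..<CHAR('a)}" for n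
    by (rule image_eqI[of _ _ "n mod CHAR('a)"]) (simp_all add: of_nat_mod_CHAR)
  then show ?thesis
    unfolding prime_subfield_def by blast
qed

lemma inj_on_of_nat_CHAR: "inj_on (of_nat :: nat \<Rightarrow> 'a :: finite_field) {..<CHAR('a)}"
  by (rule inj_onI) (auto simp: of_nat_eq_iff_cong_CHAR cong_def)

lemma prime_subfield_rep:
  fixes x :: "'a :: finite_field"
  assumes "x \<in> prime_subfield"
  shows "prime_subfield_rep x < CHAR('a)" "of_nat (prime_subfield_rep x) = x"
proof -
  have "\<exists>!n. n < CHAR('a) \<and> of_nat n = x"
    using assms inj_on_of_nat_CHAR[where 'a = 'a]
    unfolding prime_subfield_eq_image by (auto dest: inj_onD)
  from theI'[OF this]
  show "prime_subfield_rep x < CHAR('a)" "of_nat (prime_subfield_rep x) = x"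
    unfolding prime_subfield_rep_def by auto
qed

lemma of_nat_power_CHAR: "(of_nat n :: 'a :: finite_field) ^ CHAR('a) = of_nat n"
proof (induction n)
  case (Suc n)
  then show ?case
    by (simp add: freshmans_dream)
qed auto

lemma power_CHAR_eq_self_iff:
  fixes x :: "'a :: finite_field"
  shows "x ^ CHAR('a) = x \<longleftrightarrow> x \<in> prime_subfield"
proof
  let ?p = "CHAR('a)"
  let ?P = "monom 1 ?p - monom 1 1 :: 'a poly"
  have p1: "?p > 1"
    using CHAR_prime prime_gt_1_nat by blast
  have deg: "degree ?P = ?p"
    using p1 degree_add_eq_left[of "- monom 1 1 :: 'a poly" "monom 1 ?p"]
    by (simp add: degree_monom_eq)
  with p1 have nz: "?P \<noteq> 0"
    by auto
  have roots: "{y. poly ?P y = 0} = {y. y ^ ?p = y}"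
    by (simp add: poly_monom)
  have "card {y::'a. y ^ ?p = y} \<le> ?p"
    using card_poly_roots_bound[OF nz] deg roots by simp
  moreover have "card (prime_subfield :: 'a set) = ?p"
    unfolding prime_subfield_eq_image by (simp add: card_image inj_on_of_nat_CHAR)
  moreover have "(prime_subfield :: 'a set) \<subseteq> {y. y ^ ?p = y}"
    by (auto simp: prime_subfield_def of_nat_power_CHAR)
  ultimately have "(prime_subfield :: 'a set) = {y. y ^ ?p = y}"
    by (intro card_seteq) auto
  then show "x ^ ?p = x \<Longrightarrow> x \<in> prime_subfield"
    by auto
qed (auto simp: prime_subfield_def of_nat_power_CHAR)

lemma frobenius_in_galois_group: "(\<lambda>x :: 'a :: finite_field. x ^ CHAR('a)) \<in> galois_group"
proof -
  have "inj (\<lambda>x::'a. x ^ CHAR('a))"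
  proof (rule injI)
    fix x y :: 'a
    assume eq: "x ^ CHAR('a) = y ^ CHAR('a)"
    have "x ^ CHAR('a) = ((x - y) + y) ^ CHAR('a)"
      by simp
    also have "\<dots> = (x - y) ^ CHAR('a) + y ^ CHAR('a)"
      by (rule freshmans_dream) auto
    finally show "x = y"
      using eq by simp
  qed
  then have "bij (\<lambda>x::'a. x ^ CHAR('a))"
    by (simp add: bij_def finite_UNIV_inj_surj)
  then show ?thesis
    by (simp add: galois_group_def freshmans_dream power_mult_distrib power_CHAR_eq_self_iff)
qed

lemma field_trace_in_prime_subfield:
  fixes a :: "'a :: finite_field"
  shows "field_trace a \<in> prime_subfield"
proof -
  define F where "F = (\<lambda>x::'a. x ^ CHAR('a))"
  have F: "F \<in> galois_group"
    unfolding F_def by (rule frobenius_in_galois_group)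
  then have "bij F"
    by (simp add: galois_group_def)
  then have inj: "inj_on (\<lambda>\<sigma>. F \<circ> \<sigma>) galois_group"
    by (auto simp: inj_on_def fun_eq_iff bij_def dest: injD)
  have fin: "finite (galois_group :: ('a \<Rightarrow> 'a) set)"
    by simp
  have "F \<circ> \<sigma> \<in> galois_group" if "\<sigma> \<in> galois_group" for \<sigma>
    using F that by (auto simp: galois_group_def bij_comp)
  then have img: "(\<lambda>\<sigma>. F \<circ> \<sigma>) ` galois_group = galois_group"
    using fin inj by (intro endo_inj_surj) auto
  have "F (field_trace a) = (\<Sum>\<sigma>\<in>galois_group. F (\<sigma> a))"
    unfolding F_def field_trace_def by (rule freshmans_dream_sum) auto
  also have "\<dots> = (\<Sum>\<sigma>\<in>(\<lambda>\<sigma>. F \<circ> \<sigma>) ` galois_group. \<sigma> a)"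
    by (simp add: sum.reindex[OF inj])
  also have "\<dots> = field_trace a"
    by (simp add: img field_trace_def)
  finally show ?thesis
    unfolding F_def by (simp add: power_CHAR_eq_self_iff)
qed

end

theory Submission
  imports Defs "Jordan_Normal_Form.Char_Poly"
begin

text \<open>
  Put \<open>n = q - 1\<close>, \<open>\<pi> = \<zeta> - 1\<close> and let \<open>A\<close> be the ring of integers generated by the \<open>pn\<close>-th roots
  of unity. Reduction modulo a prime of \<open>A\<close> above \<open>\<pi>\<close> sends a primitive \<open>n\<close>-th root of unity \<open>\<eta>\<close> to a
  generator \<open>g\<close> of the multiplicative group of the field. Conjugating \<open>\<eta>\<close> while fixing \<open>\<zeta>\<close>
  replaces the two characters by their \<open>t\<close>-th powers, for any \<open>t\<close> coprime to \<open>n\<close>, and preserves the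
  equality of the Gauss sums; so one may assume \<open>\<chi> g = \<eta> powi - 2\<close>. Let \<open>\<chi>' g = \<eta> powi - k\<close>. As in
  Stickelberger's congruence, expand both Gauss sums in powers of \<open>\<pi>\<close>. The constant terms
  vanish, the linear terms turn out to be irrelevant, and comparing the coefficients of \<open>\<pi>\<^sup>2\<close> modulo the
  prime gives \<open>P - L = 1\<close> modulo \<open>p\<close>, where \<open>P\<close> counts the pairs \<open>(i, j)\<close> with
  \<open>p ^ i + p ^ j = k\<close> modulo \<open>n\<close> and \<open>L\<close> the \<open>i\<close> with \<open>p ^ i = k\<close> modulo \<open>n\<close>. Since \<open>p\<close> is odd,
  \<open>(P, L)\<close> is \<open>(0, 0)\<close>, \<open>(0, 1)\<close>, \<open>(1, 0)\<close> or \<open>(2, 0)\<close>, so \<open>P = 1\<close> and \<open>k = 2 * p ^ i\<close> modulo \<open>n\<close>.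
\<close>

subsection \<open>Rings of cyclotomic integers\<close>

lemma roots_of_unity_mult: "a \<in> roots_of_unity n \<Longrightarrow> b \<in> roots_of_unity n \<Longrightarrow> a * b \<in> roots_of_unity n"
  by (simp add: roots_of_unity_def power_mult_distrib)

lemma roots_of_unity_power: "a \<in> roots_of_unity n \<Longrightarrow> a ^ k \<in> roots_of_unity n"
  by (simp add: roots_of_unity_def flip: power_mult) (simp add: mult.commute[of k] power_mult)

lemma roots_of_unity_1: "1 \<in> roots_of_unity n"
  by (simp add: roots_of_unity_def)

lemma roots_of_unity_dvd: "a \<in> roots_of_unity m \<Longrightarrow> m dvd n \<Longrightarrow> a \<in> roots_of_unity n"
  by (auto simp: roots_of_unity_def power_mult elim!: dvdE)

lemma finite_roots_of_unity: "n > 0 \<Longrightarrow> finite (roots_of_unity n)"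
  unfolding roots_of_unity_def by (rule finite_roots_unity) simp

lemma card_roots_of_unity: "n > 0 \<Longrightarrow> card (roots_of_unity n) = n"
  unfolding roots_of_unity_def by (rule card_roots_unity_eq)

lemma roots_of_unity_nonzero: "n > 0 \<Longrightarrow> a \<in> roots_of_unity n \<Longrightarrow> a \<noteq> 0"
  by (auto simp: roots_of_unity_def power_0_left)

text \<open>For \<open>N > 0\<close> this is the ring generated by the \<open>N\<close>-th roots of
  unity: their integer span is already closed under products. The finite spanning set makes
  multiplication by an element an integer matrix.\<close>

definition cyc_ints :: "nat \<Rightarrow> complex set" where
  "cyc_ints N = range (\<lambda>c. \<Sum>z\<in>roots_of_unity N. of_int (c z) * z)"

text \<open>Principal ideals carry all congruences: \<open>x - y \<in> cyc_ideal N d\<close> reads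
  as congruence modulo \<open>d\<close>.\<close>

definition cyc_ideal :: "nat \<Rightarrow> complex \<Rightarrow> complex set" where
  "cyc_ideal N d = (*) d ` cyc_ints N"

locale cyclotomic =
  fixes N :: nat
  assumes N_pos: "N > 0"
begin

abbreviation A where "A \<equiv> cyc_ints N"

abbreviation I where "I \<equiv> cyc_ideal N"

lemma fin: "finite (roots_of_unity N)"
  using N_pos by (rule finite_roots_of_unity)

lemma A_combination: "(\<Sum>z\<in>roots_of_unity N. of_int (c z) * z) \<in> A"
  by (simp add: cyc_ints_def)

lemma A_add: "x \<in> A \<Longrightarrow> y \<in> A \<Longrightarrow> x + y \<in> A"
proof -
  assume "x \<in> A" "y \<in> A"
  then obtain c d where "x = (\<Sum>z\<in>roots_of_unity N. of_int (c z) * z)"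
    "y = (\<Sum>z\<in>roots_of_unity N. of_int (d z) * z)"
    by (auto simp: cyc_ints_def)
  then have "x + y = (\<Sum>z\<in>roots_of_unity N. of_int (c z + d z) * z)"
    by (simp add: sum.distrib algebra_simps)
  then show ?thesis
    by (simp only: A_combination)
qed

lemma A_of_int_mult: "x \<in> A \<Longrightarrow> of_int k * x \<in> A"
proof -
  assume "x \<in> A"
  then obtain c where "x = (\<Sum>z\<in>roots_of_unity N. of_int (c z) * z)"
    by (auto simp: cyc_ints_def)
  then have "of_int k * x = (\<Sum>z\<in>roots_of_unity N. of_int (k * c z) * z)"
    by (simp add: sum_distrib_left algebra_simps)
  then show ?thesis
    by (simp only: A_combination)
qed

lemma A_root: "w \<in> roots_of_unity N \<Longrightarrow> w \<in> A"
proof -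
  assume w: "w \<in> roots_of_unity N"
  have "(\<Sum>z\<in>roots_of_unity N. of_int (if z = w then 1 else 0) * z) =
        (\<Sum>z\<in>roots_of_unity N. if w = z then w else 0)"
    by (rule sum.cong) auto
  then have "w = (\<Sum>z\<in>roots_of_unity N. of_int (if z = w then 1 else 0) * z)"
    using w fin by simp
  then show ?thesis
    using A_combination[of "\<lambda>z. if z = w then 1 else 0"] by simp
qed

lemma A_1: "1 \<in> A"
  by (simp add: A_root roots_of_unity_1)

lemma A_of_int: "of_int k \<in> A"
  using A_of_int_mult[OF A_1, of k] by simp

lemma A_of_nat: "of_nat k \<in> A"
  using A_of_int[of "int k"] by simp

lemma A_0: "0 \<in> A"
  using A_of_int[of 0] by simp

lemma A_uminus: "x \<in> A \<Longrightarrow> - x \<in> A"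
  using A_of_int_mult[of x "-1"] by simp

lemma A_diff: "x \<in> A \<Longrightarrow> y \<in> A \<Longrightarrow> x - y \<in> A"
  using A_add[of x "- y"] A_uminus by simp

lemma A_sum: "(\<And>i. i \<in> S \<Longrightarrow> g i \<in> A) \<Longrightarrow> sum g S \<in> A"
  by (induction S rule: infinite_finite_induct) (auto intro: A_0 A_add)

lemma A_mult: "x \<in> A \<Longrightarrow> y \<in> A \<Longrightarrow> x * y \<in> A"
proof -
  assume "x \<in> A" "y \<in> A"
  then obtain c d where "x = (\<Sum>z\<in>roots_of_unity N. of_int (c z) * z)"
    "y = (\<Sum>z\<in>roots_of_unity N. of_int (d z) * z)"
    by (auto simp: cyc_ints_def)
  then have "x * y = (\<Sum>z\<in>roots_of_unity N. \<Sum>w\<in>roots_of_unity N. of_int (c z * d w) * (z * w))"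
    by (simp add: sum_product mult_ac)
  also have "\<dots> \<in> A"
    by (intro A_sum A_of_int_mult A_root roots_of_unity_mult)
  finally show ?thesis .
qed

lemma A_power: "x \<in> A \<Longrightarrow> x ^ k \<in> A"
  by (induction k) (auto intro: A_1 A_mult)

lemmas A_intros = A_0 A_1 A_of_int A_of_nat A_add A_diff A_uminus A_mult A_power A_sum

lemma A_poly: "x \<in> A \<Longrightarrow> poly (map_poly of_int P) x \<in> A"
  by (simp add: poly_altdef coeff_map_poly A_intros)

lemma I_I: "w \<in> A \<Longrightarrow> d * w \<in> I d"
  by (auto simp: cyc_ideal_def)

lemma I_0: "0 \<in> I d"
  using I_I[of 0 d] A_0 by simp

lemma I_add: "x \<in> I d \<Longrightarrow> y \<in> I d \<Longrightarrow> x + y \<in> I d"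
  by (auto simp: cyc_ideal_def A_add simp flip: distrib_left)

lemma I_uminus: "x \<in> I d \<Longrightarrow> - x \<in> I d"
  by (auto simp: cyc_ideal_def A_uminus simp flip: mult_minus_right)

lemma I_diff: "x \<in> I d \<Longrightarrow> y \<in> I d \<Longrightarrow> x - y \<in> I d"
  using I_add[of x d "- y"] I_uminus by simp

lemma I_diff_trans: "x - y \<in> I d \<Longrightarrow> y - z \<in> I d \<Longrightarrow> x - z \<in> I d"
  using I_add[of "x - y" d "y - z"] by simp

lemma I_mult: "x \<in> I d \<Longrightarrow> y \<in> A \<Longrightarrow> x * y \<in> I d"
  by (auto simp: cyc_ideal_def A_mult mult.assoc)

lemma I_mult2: "x \<in> I d \<Longrightarrow> y \<in> A \<Longrightarrow> y * x \<in> I d"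
  using I_mult[of x d y] by (simp add: mult.commute)

lemma I_sum: "(\<And>i. i \<in> S \<Longrightarrow> g i \<in> I d) \<Longrightarrow> sum g S \<in> I d"
  by (induction S rule: infinite_finite_induct) (auto intro: I_0 I_add)

lemma I_trans: "x \<in> I d \<Longrightarrow> d \<in> I e \<Longrightarrow> x \<in> I e"
  by (auto simp: cyc_ideal_def mult.assoc intro!: imageI A_mult)

lemma I_power_diff:
  assumes "x \<in> A" "y \<in> A" "x - y \<in> I d"
  shows "x ^ k - y ^ k \<in> I d"
proof (induction k)
  case (Suc k)
  have "x ^ Suc k - y ^ Suc k = x * (x ^ k - y ^ k) + (x - y) * y ^ k"
    by (simp add: algebra_simps)
  with Suc assms show ?case
    by (simp add: I_add I_mult I_mult2 A_power)
qed (simp add: I_0)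

text \<open>Multiplication by \<open>x\<close> acts on the generators of \<open>A\<close> by an integer matrix, of which \<open>x\<close> is
  an eigenvalue.\<close>

lemma A_algebraic_int:
  assumes "x \<in> A"
  shows "algebraic_int x"
proof -
  obtain rs where rs: "set rs = roots_of_unity N" "distinct rs"
    using fin finite_distinct_list by blast
  define n where "n = length rs"
  have "\<exists>c. x * z = (\<Sum>w\<in>roots_of_unity N. of_int (c w) * w)" if "z \<in> roots_of_unity N" for z
    using A_mult[OF assms A_root[OF that]] by (auto simp: cyc_ints_def)
  then obtain c where c: "\<And>z. z \<in> roots_of_unity N \<Longrightarrow>
      x * z = (\<Sum>w\<in>roots_of_unity N. of_int (c z w) * w)"
    by metis
  define C where "C = mat n n (\<lambda>(i, j). c (rs ! i) (rs ! j))"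
  define v where "v = vec n (\<lambda>i. rs ! i)"
  have C: "C \<in> carrier_mat n n"
    by (simp add: C_def)
  have "map_mat of_int C *\<^sub>v v = x \<cdot>\<^sub>v v"
  proof (rule eq_vecI)
    fix i assume "i < dim_vec (x \<cdot>\<^sub>v v)"
    then have i: "i < n"
      by (simp add: v_def)
    have "x * rs ! i = (\<Sum>w\<in>set rs. of_int (c (rs ! i) w) * w)"
      unfolding rs(1) using i rs(1) nth_mem by (intro c) (auto simp: n_def)
    also have "\<dots> = (\<Sum>j<n. of_int (c (rs ! i) (rs ! j)) * rs ! j)"
      by (rule sum.reindex_bij_betw[symmetric, OF bij_betw_nth]) (auto simp: rs n_def)
    finally show "(map_mat of_int C *\<^sub>v v) $ i = (x \<cdot>\<^sub>v v) $ i"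
      using i by (simp add: C_def v_def scalar_prod_def atLeast0LessThan)
  qed (simp add: C_def v_def)
  moreover have "v \<noteq> 0\<^sub>v n"
  proof -
    have "1 \<in> set rs"
      by (simp add: rs roots_of_unity_1)
    then obtain i where "i < n" "rs ! i = 1"
      by (auto simp: in_set_conv_nth n_def)
    then have "v $ i \<noteq> 0\<^sub>v n $ i"
      by (simp add: v_def)
    then show ?thesis
      by metis
  qed
  ultimately have "eigenvalue (map_mat of_int C) x"
    unfolding eigenvalue_def eigenvector_def using C by (intro exI[of _ v]) (auto simp: v_def)
  then have "poly (char_poly (map_mat of_int C)) x = 0"
    using C by (subst (asm) eigenvalue_root_char_poly[of _ n]) auto
  then have "poly (map_poly of_int (char_poly C)) x = 0"
    by (simp add: of_int_hom.char_poly_hom[OF C])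
  moreover have "lead_coeff (char_poly C) = 1"
    using degree_monic_char_poly[OF C] by simp
  ultimately show ?thesis
    unfolding algebraic_int_altdef_ipoly by blast
qed

text \<open>For \<open>l \<noteq> 0\<close> the quotient \<open>a / l\<close> is rational and an
  algebraic integer, hence an integer. Divisibility in \<open>A\<close> thus becomes divisibility of
  integers.\<close>

lemma of_int_in_I:
  assumes "of_int a \<in> I (of_int l)"
  shows "l dvd a"
proof (cases "l = 0")
  case False
  from assms obtain w where w: "w \<in> A" "of_int a = of_int l * w"
    by (auto simp: cyc_ideal_def)
  with False have eq: "w = of_int a / of_int l"
    by simp
  have "w \<in> \<int>"
  proof (rule rational_algebraic_int_is_int)
    show "algebraic_int w"
      using w(1) by (rule A_algebraic_int)
    show "w \<in> \<rat>"
      by (simp add: eq)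
  qed
  then obtain k where "w = of_int k"
    by (auto elim: Ints_cases)
  with w have "of_int a = (of_int (l * k) :: complex)"
    by simp
  then show ?thesis
    by (simp only: of_int_eq_iff dvd_triv_left)
qed (use assms in \<open>auto simp: cyc_ideal_def\<close>)

text \<open>The constant term of an integer polynomial with root \<open>x\<close> is a multiple of
  \<open>x\<close>. It is nonzero once the factors X are cancelled, which
  \<open>x \<noteq> 0\<close> permits.\<close>

lemma int_multiple:
  assumes "x \<in> A" "x \<noteq> 0"
  obtains a where "a \<noteq> 0" "of_int a \<in> I x"
proof -
  have "\<exists>a. a \<noteq> 0 \<and> of_int a \<in> I x" if "P \<noteq> 0" "poly (map_poly of_int P) x = 0" for P
    using that
  proof (induction P)
    case (pCons a P)
    let ?e = "poly (map_poly of_int P) x"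
    have eq: "of_int a + x * ?e = 0"
      using pCons.prems by (simp add: map_poly_pCons)
    show ?case
    proof (cases "a = 0")
      case True
      then show ?thesis
        using eq assms pCons by (auto split: if_splits)
    next
      case False
      have "of_int a = x * (- ?e)"
        using eq by (simp add: add_eq_0_iff)
      then show ?thesis
        using False I_I[OF A_uminus[OF A_poly[OF assms(1)]], of x P] by metis
    qed
  qed simp
  moreover obtain P where "poly (map_poly of_int P) x = 0" "lead_coeff P = 1"
    using A_algebraic_int[OF assms(1)] unfolding algebraic_int_altdef_ipoly by blast
  moreover from this have "P \<noteq> 0"
    by auto
  ultimately show ?thesis
    using that by blast
qed

section \<open>Frobenius congruences modulo a prime number\<close>

lemma frob_add:
  assumes l: "prime l" and "x \<in> A" "y \<in> A"
  shows "(x + y) ^ l - (x ^ l + y ^ l) \<in> I (of_nat l)"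
proof -
  have l0: "l > 0"
    using l by (simp add: prime_gt_0_nat)
  let ?t = "\<lambda>k. of_nat (l choose k) * x ^ k * y ^ (l - k)"
  have "(x + y) ^ l = (\<Sum>k\<in>{..l}. ?t k)"
    by (simp add: binomial_ring)
  also have "{..l} = insert 0 (insert l {0<..<l})"
    using l0 by auto
  also have "(\<Sum>k\<in>\<dots>. ?t k) = x ^ l + y ^ l + (\<Sum>k\<in>{0<..<l}. ?t k)"
    using l0 by simp
  finally have "(x + y) ^ l - (x ^ l + y ^ l) = (\<Sum>k\<in>{0<..<l}. ?t k)"
    by simp
  also have "\<dots> \<in> I (of_nat l)"
  proof (rule I_sum)
    fix k assume "k \<in> {0<..<l}"
    then have "l dvd (l choose k)"
      using l by (intro dvd_choose_prime) auto
    then obtain b where "l choose k = l * b" ..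
    then have "?t k = of_nat l * (of_nat b * x ^ k * y ^ (l - k))"
      by (simp add: mult_ac)
    also have "\<dots> \<in> I (of_nat l)"
      using assms by (intro I_I A_intros)
    finally show "?t k \<in> I (of_nat l)" .
  qed
  finally show ?thesis .
qed

lemma frob_sum:
  assumes l: "prime l" and "finite S" "\<And>i. i \<in> S \<Longrightarrow> g i \<in> A"
  shows "(\<Sum>i\<in>S. g i) ^ l - (\<Sum>i\<in>S. g i ^ l) \<in> I (of_nat l)"
  using assms(2,3)
proof (induction S)
  case empty
  then show ?case
    using l by (simp add: I_0 prime_gt_0_nat power_0_left)
next
  case (insert i S)
  let ?s = "sum g S" and ?r = "\<Sum>i\<in>S. g i ^ l"
  have "((g i + ?s) ^ l - (g i ^ l + ?s ^ l)) + (?s ^ l - ?r) \<in> I (of_nat l)"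
    using insert by (intro I_add frob_add l) (auto intro: A_sum)
  with insert show ?case
    by (simp add: algebra_simps)
qed

lemma frob_add_power:
  assumes l: "prime l" and "x \<in> A" "y \<in> A"
  shows "(x + y) ^ (l ^ k) - (x ^ (l ^ k) + y ^ (l ^ k)) \<in> I (of_nat l)"
proof (induction k)
  case (Suc k)
  let ?q = "l ^ k"
  have "((x + y) ^ ?q) ^ l - (x ^ ?q + y ^ ?q) ^ l \<in> I (of_nat l)"
    using assms Suc by (intro I_power_diff A_intros)
  moreover have "(x ^ ?q + y ^ ?q) ^ l - ((x ^ ?q) ^ l + (y ^ ?q) ^ l) \<in> I (of_nat l)"
    using assms by (intro frob_add A_intros)
  ultimately have "((x + y) ^ ?q) ^ l - ((x ^ ?q) ^ l + (y ^ ?q) ^ l) \<in> I (of_nat l)"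
    by (rule I_diff_trans)
  then show ?case
    by (simp add: mult.commute[of l] power_mult)
qed (simp add: I_0)

text \<open>Induction with \<open>frob_add\<close> covers the natural numbers; any other integer is
  replaced by its remainder modulo \<open>l\<close>.\<close>

lemma fermat_int:
  fixes c :: int
  assumes "prime l"
  shows "(of_int c :: complex) ^ l - of_int c \<in> I (of_nat l)"
proof -
  have pos: "(of_nat m :: complex) ^ l - of_nat m \<in> I (of_nat l)" for m
  proof (induction m)
    case (Suc m)
    have "((of_nat m + 1) ^ l - (of_nat m ^ l + 1 ^ l)) + (of_nat m ^ l - of_nat m) \<in> I (of_nat l)"
      using assms Suc by (intro I_add frob_add A_intros)
    then show ?case
      by (simp add: algebra_simps)
  qed (use assms in \<open>simp add: I_0 prime_gt_0_nat power_0_left\<close>)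
  obtain m where m: "of_int c - (of_nat m :: complex) \<in> I (of_nat l)"
  proof
    have "l > 0"
      using assms by (simp add: prime_gt_0_nat)
    then have "int (nat (c mod int l)) = c mod int l"
      by simp
    also have "\<dots> = c - int l * (c div int l)"
      by (simp add: minus_mult_div_eq_mod)
    finally have "c - int (nat (c mod int l)) = int l * (c div int l)"
      by simp
    from arg_cong[OF this, of of_int]
    have "of_int c - (of_nat (nat (c mod int l)) :: complex) = of_nat l * of_int (c div int l)"
      by (simp only: of_int_diff of_int_mult of_int_of_nat_eq)
    then show "of_int c - (of_nat (nat (c mod int l)) :: complex) \<in> I (of_nat l)"
      using I_I[OF A_of_int[of "c div int l"], of "of_nat l"] by (simp only:)
  qed
  have "of_int c ^ l - of_nat m ^ l \<in> I (of_nat l)"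
    by (intro I_power_diff m A_intros)
  then have "of_int c ^ l - of_nat m \<in> I (of_nat l)"
    using pos by (rule I_diff_trans)
  moreover have "of_nat m - of_int c \<in> I (of_nat l)"
    using I_uminus[OF m] by simp
  ultimately show ?thesis
    by (rule I_diff_trans)
qed

text \<open>Raise the vanishing sum to the \<open>l\<close>-th power: modulo \<open>l\<close> this
  acts termwise, and Fermat's theorem removes the power from the coefficients.\<close>

lemma prime_conj_in_I:
  assumes l: "prime l" and S: "finite S" and g: "\<And>i. i \<in> S \<Longrightarrow> g i \<in> A"
    and "(\<Sum>i\<in>S. of_int (c i) * g i) = 0"
  shows "(\<Sum>i\<in>S. of_int (c i) * g i ^ l) \<in> I (of_nat l)"
proof -
  let ?s = "\<lambda>h. \<Sum>i\<in>S. h i"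
  have "?s (\<lambda>i. of_int (c i) * g i) ^ l - ?s (\<lambda>i. (of_int (c i) * g i) ^ l) \<in> I (of_nat l)"
    by (intro frob_sum l S A_mult A_of_int g)
  moreover have "?s (\<lambda>i. of_int (c i) * g i) ^ l = 0"
    using assms(4) prime_gt_0_nat[OF l] by simp
  ultimately have 1: "?s (\<lambda>i. (of_int (c i) * g i) ^ l) \<in> I (of_nat l)"
    using I_uminus[of "- ?s (\<lambda>i. (of_int (c i) * g i) ^ l)"] by simp
  have "?s (\<lambda>i. (of_int (c i) ^ l - of_int (c i)) * g i ^ l) \<in> I (of_nat l)"
    by (intro I_sum I_mult fermat_int l A_power g)
  from I_diff[OF 1 this] show ?thesis
    by (simp add: algebra_simps sum_subtractf power_mult_distrib)
qed

end

subsection \<open>Galois conjugation\<close>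

text \<open>Add to \<open>t\<close> the multiple \<open>N * D\<close>, where \<open>D\<close> is the
  product of the primes up to \<open>B\<close> that do not divide \<open>t\<close>. Each prime up to
  \<open>B\<close> then divides exactly one of \<open>t\<close> and \<open>N * D\<close>, so it does
  not divide the sum.\<close>

lemma coprime_imp_cong_large_primes:
  fixes t N B :: nat
  assumes "coprime t N" "N > 0"
  obtains t' where "[t' = t] (mod N)" "t' > 0" "\<And>l. prime l \<Longrightarrow> l dvd t' \<Longrightarrow> l > B"
proof -
  define R where "R = {r. prime r \<and> r \<le> B \<and> \<not> r dvd t}"
  define D where "D = \<Prod>R"
  have fin: "finite R"
    unfolding R_def by (rule finite_subset[of _ "{..B}"]) auto
  have D0: "D > 0"
    unfolding D_def by (rule prod_pos) (auto simp: R_def prime_gt_0_nat)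
  show ?thesis
  proof
    show "[t + N * D = t] (mod N)"
      by (simp add: cong_def)
    show "t + N * D > 0"
      using assms(2) D0 by simp
    fix l assume l: "prime l" "l dvd t + N * D"
    show "l > B"
    proof (rule ccontr)
      assume "\<not> l > B"
      then have B: "l \<le> B"
        by simp
      show False
      proof (cases "l dvd t")
        case True
        with l have "l dvd N * D"
          by (simp add: dvd_add_right_iff)
        then have "l dvd N \<or> l dvd D"
          using l(1) prime_dvd_mult_iff by blast
        moreover have "\<not> l dvd N"
          using True assms(1) l(1) by (meson coprime_common_divisor not_prime_unit)
        moreover have "\<not> l dvd D"
        proof
          assume "l dvd D"
          then obtain r where "r \<in> R" "l dvd r"
            using l(1) fin by (auto simp: D_def prime_dvd_prod_iff)
          with l(1) True show False
            using primes_dvd_imp_eq by (auto simp: R_def)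
        qed
        ultimately show False
          by blast
      next
        case False
        then have "l dvd D"
          unfolding D_def using l B fin by (intro dvd_prodI) (auto simp: R_def)
        with l False show False
          by (simp add: dvd_add_left_iff)
      qed
    qed
  qed
qed

context cyclotomic
begin

text \<open>Landau's argument: the conjugates \<open>y k\<close> of a vanishing sum take finitely many values, and for
  a prime \<open>l\<close> exceeding a bound depending on these values \<open>y k = 0\<close> implies \<open>y (k * l) = 0\<close>,
  because \<open>l\<close> divides \<open>y (k * l)\<close>. Any \<open>t\<close> coprime to \<open>N\<close> is congruent modulo \<open>N\<close> to a product
  of such primes.\<close>

lemma galois_conj:
  fixes c :: "'i \<Rightarrow> int"
  assumes S: "finite S" and r: "\<And>i. i \<in> S \<Longrightarrow> r i \<in> roots_of_unity N"
    and zero: "(\<Sum>i\<in>S. of_int (c i) * r i) = 0" and t: "coprime t N"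
  shows "(\<Sum>i\<in>S. of_int (c i) * r i ^ t) = 0"
proof -
  define y where "y k = (\<Sum>i\<in>S. of_int (c i) * r i ^ k)" for k
  have y_A: "y k \<in> A" for k
    unfolding y_def by (intro A_sum A_mult A_of_int A_power A_root r)
  have y_cong: "y k = y k'" if "[k = k'] (mod N)" for k k'
  proof -
    have *: "r i ^ k = r i ^ (k mod N)" if "i \<in> S" for i k
    proof -
      have "r i ^ k = r i ^ (N * (k div N) + k mod N)"
        by simp
      also have "\<dots> = r i ^ (k mod N)"
        using r[OF that] by (simp only: power_add power_mult) (simp add: roots_of_unity_def)
      finally show ?thesis .
    qed
    show ?thesis
      unfolding y_def using that by (intro sum.cong refl) (simp add: *[of _ k] *[of _ k'] cong_def)
  qed
  \<comment> \<open>A prime \<open>l\<close> dividing a nonzero \<open>y k\<close> in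
    \<open>A\<close> also divides the integer \<open>a k\<close>. As \<open>y\<close> has period
    \<open>N\<close>, the indices below \<open>N\<close> suffice, and \<open>B\<close> bounds all
    such primes.\<close>
  have "\<exists>a. a \<noteq> 0 \<and> (y k \<noteq> 0 \<longrightarrow> of_int a \<in> I (y k))" for k
    using int_multiple[OF y_A] by (metis one_neq_zero)
  then obtain a where a: "\<And>k. a k \<noteq> 0" "\<And>k. y k \<noteq> 0 \<Longrightarrow> of_int (a k) \<in> I (y k)"
    by metis
  define B where "B = (\<Sum>k<N. nat \<bar>a k\<bar>)"
  have step: "y (k * l) = 0" if l: "prime l" "l > B" and "y k = 0" for k l
  proof (rule ccontr)
    assume nz: "y (k * l) \<noteq> 0"
    define j where "j = (k * l) mod N"
    have j: "j < N" "y (k * l) = y j"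
      using N_pos by (auto simp: j_def intro!: y_cong)
    have "y (k * l) \<in> I (of_nat l)"
      using prime_conj_in_I[OF l(1) S, of "\<lambda>i. r i ^ k" c] that(3) r
      by (simp add: y_def power_mult A_power A_root)
    then have "of_int (a j) \<in> I (of_int (int l))"
      using a(2)[of j] nz j(2) by (auto intro: I_trans)
    then have "int l dvd a j"
      by (rule of_int_in_I)
    then have "l \<le> nat \<bar>a j\<bar>"
      using a(1)[of j] dvd_imp_le_int[of "a j" "int l"] by simp
    also have "nat \<bar>a j\<bar> \<le> B"
      unfolding B_def using j(1) by (intro member_le_sum) auto
    finally show False
      using l(2) by simp
  qed
  obtain t' where t': "[t' = t] (mod N)" "t' > 0" "\<And>l. prime l \<Longrightarrow> l dvd t' \<Longrightarrow> l > B"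
    using coprime_imp_cong_large_primes[OF t N_pos] by blast
  have "y m = 0" if "m > 0" "\<And>l. prime l \<Longrightarrow> l dvd m \<Longrightarrow> l > B" for m
    using that
  proof (induction m rule: less_induct)
    case (less m)
    show ?case
    proof (cases "m = 1")
      case True
      then show ?thesis
        using zero by (simp add: y_def)
    next
      case False
      then obtain l where l: "prime l" "l dvd m"
        using prime_factor_nat by blast
      then obtain m' where m': "m = m' * l"
        by (metis dvd_div_mult_self)
      have "y m' = 0"
        using less.prems l prime_gt_1_nat[OF l(1)] by (intro less.IH) (auto simp: m')
      then show ?thesis
        unfolding m' using l less.prems by (intro step) auto
    qed
  qed
  then have "y t' = 0"
    using t' by blast
  then show ?thesis
    using y_cong[OF t'(1)] by (simp add: y_def)
qed

end

subsection \<open>Finite fields\<close>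

text \<open>Translation by 1 permutes the field, so adding \<open>CARD('a)\<close> to the sum of all
  elements does not change it.\<close>

lemma of_nat_CARD_eq_0: "of_nat CARD('a) = (0 :: 'a :: finite_field)"
proof -
  have "(\<Sum>x\<in>UNIV. x + 1) = (\<Sum>x\<in>UNIV. x :: 'a)"
    by (rule sum.reindex_bij_witness[of _ "\<lambda>x. x - 1" "\<lambda>x. x + 1"]) auto
  then show ?thesis
    by (simp add: sum.distrib)
qed

lemma CHAR_eq_of_CARD:
  assumes "prime p" "CARD('a :: finite_field) = p ^ f"
  shows "CHAR('a) = p"
proof -
  have "CHAR('a) dvd p ^ f"
    using of_nat_CARD_eq_0[where 'a = 'a] unfolding assms(2) of_nat_eq_0_iff_char_dvd .
  then show ?thesis
    using CHAR_prime[where 'a = 'a] assms(1)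
    by (metis CHAR_prime prime_dvd_power primes_dvd_imp_eq)
qed

lemma power_CARD_minus_1:
  fixes x :: "'a :: finite_field"
  assumes "x \<noteq> 0"
  shows "x ^ (CARD('a) - 1) = 1"
proof -
  have "x ^ (CARD('a) - 1) * x = x"
    using finite_field_power_card_eq_same[of x] power_minus_mult[of "CARD('a)" x] by simp
  with assms show ?thesis
    by simp
qed

lemma power_eq_1_of_dvd:
  fixes x :: "'a :: finite_field"
  assumes "x \<noteq> 0" "CARD('a) - 1 dvd k"
  shows "x ^ k = 1"
  using assms power_CARD_minus_1[of x] by (auto simp: power_mult elim!: dvdE)

lemma power_cong_CARD_minus_1:
  fixes x :: "'a :: finite_field"
  assumes "x \<noteq> 0" "[k = k'] (mod (CARD('a) - 1))"
  shows "x ^ k = x ^ k'"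
proof -
  have "x ^ k = x ^ (k mod (CARD('a) - 1))" for k
  proof -
    have "x ^ k = x ^ ((CARD('a) - 1) * (k div (CARD('a) - 1)) + k mod (CARD('a) - 1))"
      by simp
    also have "\<dots> = x ^ (k mod (CARD('a) - 1))"
      by (simp only: power_add power_mult power_CARD_minus_1[OF assms(1)] power_one mult_1_left)
    finally show ?thesis .
  qed
  from this[of k] this[of k'] show ?thesis
    using assms(2) by (simp add: cong_def)
qed

lemma CARD_field_gt_1: "CARD('a :: finite_field) > 1"
  using card_mono[of UNIV "{0, 1 :: 'a}"] by simp

lemma of_nat_CARD_minus_1: "of_nat (CARD('a) - 1) = (- 1 :: 'a :: finite_field)"
  using CARD_field_gt_1[where 'a = 'a] of_nat_CARD_eq_0[where 'a = 'a] by (simp add: of_nat_diff)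

text \<open>For the remainder \<open>r\<close> of \<open>k\<close>, the polynomial X^r - 1 has at
  most \<open>r\<close> roots, fewer than there are nonzero elements.\<close>

lemma exists_power_neq_1:
  assumes "\<not> CARD('a :: finite_field) - 1 dvd k"
  obtains a :: "'a :: finite_field" where "a \<noteq> 0" "a ^ k \<noteq> 1"
proof -
  define n where "n = CARD('a) - 1"
  define r where "r = k mod n"
  have n: "n > 0"
    using CARD_field_gt_1[where 'a = 'a] by (simp add: n_def)
  have r: "r > 0" "r < n"
    using assms[folded n_def] n by (auto simp: r_def intro!: Nat.gr0I)
  have "\<exists>a::'a. a \<noteq> 0 \<and> a ^ r \<noteq> 1"
  proof (rule ccontr)
    assume "\<not> ?thesis"
    then have "UNIV - {0} \<subseteq> {a :: 'a. poly (monom 1 r - 1) a = 0}"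
      by (auto simp: poly_monom)
    moreover have deg: "degree (monom 1 r - 1 :: 'a poly) = r"
      using r(1) degree_add_eq_left[of "- 1 :: 'a poly" "monom 1 r"] by (simp add: degree_monom_eq)
    then have nz: "monom 1 r - 1 \<noteq> (0 :: 'a poly)"
      using r(1) by auto
    ultimately have "card (UNIV - {0 :: 'a}) \<le> r"
      using card_poly_roots_bound[OF nz] deg card_mono[of "{a :: 'a. poly (monom 1 r - 1) a = 0}" "UNIV - {0}"]
      by simp
    with r(2) show False
      by (simp add: n_def card_Diff_subset)
  qed
  then obtain a :: 'a where a: "a \<noteq> 0" "a ^ r \<noteq> 1"
    by blast
  have "a ^ k = a ^ r"
    using a(1) by (rule power_cong_CARD_minus_1) (simp add: r_def n_def cong_def)
  then show ?thesis
    using a that by simp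
qed

text \<open>Multiplying the index by some \<open>b\<close> with \<open>b ^ k \<noteq> 1\<close>
  rescales the sum by \<open>b ^ k\<close>, so it vanishes. If all terms are 1, their number
  \<open>CARD('a) - 1\<close> is -1 in the field.\<close>

lemma sum_nonzero_powers:
  "(\<Sum>a\<in>UNIV - {0}. a ^ k) = (if CARD('a) - 1 dvd k then - 1 else (0 :: 'a :: finite_field))"
proof (cases "CARD('a) - 1 dvd k")
  case True
  then have "(\<Sum>a\<in>UNIV - {0}. a ^ k) = (\<Sum>a\<in>UNIV - {0 :: 'a}. 1 :: 'a)"
    by (intro sum.cong) (auto simp: power_eq_1_of_dvd)
  also have "\<dots> = of_nat (CARD('a) - 1)"
    by (simp add: card_Diff_subset)
  finally show ?thesis
    using True by (simp only: of_nat_CARD_minus_1 if_True)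
next
  case False
  then obtain b :: 'a where b: "b \<noteq> 0" "b ^ k \<noteq> 1"
    by (rule exists_power_neq_1)
  have "(\<Sum>a\<in>UNIV - {0 :: 'a}. a ^ k) = (\<Sum>a\<in>UNIV - {0}. (b * a) ^ k)"
    by (rule sum.reindex_bij_witness[of _ "\<lambda>a. b * a" "\<lambda>a. a / b"]) (use b in auto)
  also have "\<dots> = b ^ k * (\<Sum>a\<in>UNIV - {0}. a ^ k)"
    by (simp add: power_mult_distrib sum_distrib_left)
  finally show ?thesis
    using b False by simp
qed

lemma power_CHAR_power_add:
  "(x + y :: 'a :: finite_field) ^ (CHAR('a) ^ k) = x ^ (CHAR('a) ^ k) + y ^ (CHAR('a) ^ k)"
  by (rule freshmans_dream') auto

lemma frobenius_power_in_galois_group: "(\<lambda>x :: 'a :: finite_field. x ^ (CHAR('a) ^ k)) \<in> galois_group"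
proof (induction k)
  case 0
  have "bij (\<lambda>x :: 'a. x)"
    using bij_id by (simp add: id_def)
  then show ?case
    by (simp add: galois_group_def)
next
  case (Suc k)
  have "(\<lambda>x::'a. x ^ CHAR('a)) \<circ> (\<lambda>x. x ^ (CHAR('a) ^ k)) \<in> galois_group"
    using Suc frobenius_in_galois_group[where 'a = 'a]
    unfolding galois_group_def by (auto simp: bij_comp simp del: o_apply) auto
  moreover have "(\<lambda>x::'a. x ^ CHAR('a)) \<circ> (\<lambda>x. x ^ (CHAR('a) ^ k)) = (\<lambda>x. x ^ (CHAR('a) ^ Suc k))"
    by (simp add: fun_eq_iff mult.commute flip: power_mult)
  ultimately show ?case
    by simp
qed

text \<open>Bijectivity of Frobenius removes the largest power of the characteristic from
  \<open>s\<close> and leaves an exponent \<open>b\<close> prime to it. Then (1 + X)^b = 1 + X^b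
  holds as an identity of polynomials, since the degree is smaller than the number of
  points.\<close>

lemma additive_power_imp_char_power:
  assumes s: "s > 0" "s < CARD('a :: finite_field)"
    and add: "\<And>x :: 'a. (1 + x) ^ s = 1 + x ^ s"
  obtains e where "s = CHAR('a) ^ e"
proof -
  let ?p = "CHAR('a)"
  have p1: "?p > 1"
    using CHAR_prime[where 'a = 'a] prime_gt_1_nat by blast
  have "s \<noteq> 0" "\<not> is_unit ?p"
    using s(1) p1 by auto
  then obtain b where eb': "s = ?p ^ multiplicity ?p s * b" "\<not> ?p dvd b"
    by (rule multiplicity_decompose')
  define e where "e = multiplicity ?p s"
  have eb: "s = ?p ^ e * b" "\<not> ?p dvd b"
    using eb' by (simp_all add: e_def)
  have "bij (\<lambda>x :: 'a. x ^ (?p ^ e))"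
    using frobenius_power_in_galois_group[where 'a = 'a and k = e] by (simp add: galois_group_def)
  then have surj: "\<exists>x. y = x ^ (?p ^ e)" for y :: 'a
    by (metis bij_pointE)
  have add': "(1 + y) ^ b = 1 + y ^ b" for y :: 'a
  proof -
    obtain x where x: "y = x ^ (?p ^ e)"
      using surj by blast
    show ?thesis
      using add[of x] power_CHAR_power_add[of 1 x e] by (simp add: x eb(1) power_mult)
  qed
  let ?P = "[:1, 1:] ^ b - monom 1 b - 1 :: 'a poly"
  have "b > 0"
    using s(1) eb by (cases b) auto
  have "degree ?P \<le> b"
    by (intro degree_diff_le degree_monom_le) (auto simp: degree_power_eq)
  also have "b \<le> s"
    using eb(1) p1 by simp
  also note s(2)
  finally have "degree ?P < CARD('a)" .
  moreover have "{x. poly ?P x = 0} = UNIV"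
    using add' by (auto simp: poly_monom add.commute)
  ultimately have "?P = 0"
    using card_poly_roots_bound[of ?P] by force
  \<comment> \<open>The derivative at 0 compares linear coefficients: \<open>0 ^ (b - 1)\<close>
    vanishes unless \<open>b = 1\<close>, while \<open>b\<close> is nonzero in the field.\<close>
  then have "poly (pderiv ?P) 0 = 0"
    by simp
  then have "(of_nat b :: 'a) = of_nat b * 0 ^ (b - 1)"
    by (simp add: pderiv_diff pderiv_power pderiv_monom poly_monom pderiv_pCons)
  moreover have "of_nat b \<noteq> (0 :: 'a)"
    using eb(2) by (simp add: of_nat_eq_0_iff_char_dvd)
  ultimately have "b = 1"
    using \<open>b > 0\<close> by (cases "b = 1") (auto simp: power_0_left)
  then show ?thesis
    using eb(1) that by simp
qed

lemma inj_on_frobenius_powers: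
  assumes "CARD('a :: finite_field) = CHAR('a) ^ f"
  shows "inj_on (\<lambda>i x :: 'a. x ^ (CHAR('a) ^ i)) {..<f}"
proof (rule linorder_inj_onI')
  fix i j assume ij: "i \<in> {..<f}" "j \<in> {..<f}" "i < j"
  let ?p = "CHAR('a)"
  have p1: "?p > 1"
    using CHAR_prime[where 'a = 'a] prime_gt_1_nat by blast
  have "?p ^ i < ?p ^ j" "?p ^ j < ?p ^ f"
    using ij p1 by (auto intro: power_strict_increasing)
  moreover have "?p ^ i > 0"
    using p1 by simp
  ultimately have "\<not> CARD('a) - 1 dvd ?p ^ j - ?p ^ i"
    using dvd_imp_le[of "CARD('a) - 1" "?p ^ j - ?p ^ i"] assms by linarith
  then obtain a :: 'a where a: "a \<noteq> 0" "a ^ (?p ^ j - ?p ^ i) \<noteq> 1"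
    by (rule exists_power_neq_1)
  have "a ^ (?p ^ j) = a ^ (?p ^ i) * a ^ (?p ^ j - ?p ^ i)"
    using \<open>?p ^ i < ?p ^ j\<close> by (simp flip: power_add)
  with a have "a ^ (?p ^ i) \<noteq> a ^ (?p ^ j)"
    by simp
  then show "(\<lambda>x :: 'a. x ^ (?p ^ i)) \<noteq> (\<lambda>x. x ^ (?p ^ j))"
    by metis
qed

text \<open>An automorphism is determined by the image of the generator \<open>g\<close>, so it is a
  power map; additivity makes the exponent a power of the characteristic.\<close>

lemma galois_group_eq:
  fixes g :: "'a :: finite_field"
  assumes card: "CARD('a) = CHAR('a) ^ f"
    and g0: "g \<noteq> 0" and g: "\<And>a. a \<noteq> 0 \<Longrightarrow> \<exists>i. a = g ^ i"
  shows "galois_group = (\<lambda>i x :: 'a. x ^ (CHAR('a) ^ i)) ` {..<f}"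
proof (intro equalityI subsetI)
  fix \<sigma> :: "'a \<Rightarrow> 'a" assume \<sigma>: "\<sigma> \<in> galois_group"
  define n where "n = CARD('a) - 1"
  let ?p = "CHAR('a)"
  have p1: "?p > 1"
    using CHAR_prime[where 'a = 'a] prime_gt_1_nat by blast
  have n: "n > 0"
    using CARD_field_gt_1[where 'a = 'a] by (simp add: n_def)
  have mult: "\<sigma> (x * y) = \<sigma> x * \<sigma> y" and add: "\<sigma> (x + y) = \<sigma> x + \<sigma> y" and inj: "inj \<sigma>" for x y
    using \<sigma> by (auto simp: galois_group_def bij_def)
  have \<sigma>0: "\<sigma> 0 = 0"
    using add[of 0 0] by (metis add_cancel_left_right)
  have "of_nat 1 \<in> (prime_subfield :: 'a set)"
    unfolding prime_subfield_def by blast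
  then have \<sigma>1: "\<sigma> 1 = 1"
    using \<sigma> by (auto simp: galois_group_def)
  have \<sigma>pow: "\<sigma> (x ^ i) = \<sigma> x ^ i" for x i
    by (induction i) (simp_all add: \<sigma>1 mult)
  have "\<sigma> g \<noteq> 0"
    using inj \<sigma>0 g0 by (metis injD)
  then obtain s0 where s0: "\<sigma> g = g ^ s0"
    using g by blast
  \<comment> \<open>The representative is taken in \<open>{1..n}\<close> instead of
    \<open>{0..<n}\<close>: a positive exponent keeps \<open>\<sigma> 0 = 0 ^ s\<close>.\<close>
  define s where "s = (if s0 mod n = 0 then n else s0 mod n)"
  have s: "s > 0" "s \<le> n" "[s0 = s] (mod n)"
    using n by (auto simp: s_def cong_def)
  have \<sigma>s: "\<sigma> a = a ^ s" for a
  proof (cases "a = 0")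
    case False
    then obtain i where i: "a = g ^ i"
      using g by blast
    have "\<sigma> a = a ^ s0"
      by (simp add: i \<sigma>pow s0 mult.commute flip: power_mult)
    also have "\<dots> = a ^ s"
      using False s(3) unfolding n_def by (rule power_cong_CARD_minus_1)
    finally show ?thesis .
  qed (use s(1) \<sigma>0 in auto)
  have "(1 + x) ^ s = 1 + x ^ s" for x :: 'a
    using add[of 1 x] unfolding \<sigma>1 by (simp add: \<sigma>s)
  moreover have "s < CARD('a)"
    using s(2) n by (simp add: n_def)
  ultimately obtain e where e: "s = ?p ^ e"
    using s(1) additive_power_imp_char_power by blast
  have "?p ^ e < ?p ^ f"
    using e s(2) n card by (simp add: n_def)
  then have "e < f"
    using p1 by simp
  then show "\<sigma> \<in> (\<lambda>i x :: 'a. x ^ (?p ^ i)) ` {..<f}"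
    using \<sigma>s e by auto
qed (auto intro: frobenius_power_in_galois_group)


section \<open>Moments of the trace and the congruences between exponents\<close>

text \<open>For \<open>k = - m\<close> these are the ordered pairs counted by \<open>P\<close>, and
  \<open>single_sols\<close> is the set counted by \<open>L\<close>.\<close>

definition pair_sols :: "nat \<Rightarrow> nat \<Rightarrow> nat \<Rightarrow> (nat \<times> nat) set" where
  "pair_sols p f m = {(i, j) \<in> {..<f} \<times> {..<f}. p ^ f - 1 dvd m + p ^ i + p ^ j}"

definition single_sols :: "nat \<Rightarrow> nat \<Rightarrow> nat \<Rightarrow> nat set" where
  "single_sols p f m = {i \<in> {..<f}. p ^ f - 1 dvd m + p ^ i}"

lemma field_trace_eq:
  fixes g :: "'a :: finite_field"
  assumes card: "CARD('a) = CHAR('a) ^ f"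
    and g0: "g \<noteq> 0" and g: "\<And>a. a \<noteq> 0 \<Longrightarrow> \<exists>i. a = g ^ i"
  shows "field_trace (a :: 'a) = (\<Sum>i<f. a ^ (CHAR('a) ^ i))"
proof -
  have "galois_group = (\<lambda>i x :: 'a. x ^ (CHAR('a) ^ i)) ` {..<f}"
    using assms by (rule galois_group_eq)
  then have "field_trace a = (\<Sum>\<sigma>\<in>(\<lambda>i x :: 'a. x ^ (CHAR('a) ^ i)) ` {..<f}. \<sigma> a)"
    by (simp only: field_trace_def)
  also have "\<dots> = (\<Sum>i<f. a ^ (CHAR('a) ^ i))"
    using sum.reindex[OF inj_on_frobenius_powers[OF card], of "\<lambda>\<sigma>. \<sigma> a"] by (simp add: o_def)
  finally show ?thesis .
qed

text \<open>Expand \<open>Tr\<close> and its square into monomials; each exponent divisible by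
  \<open>CARD('a) - 1\<close> contributes -1. The factor \<open>Tr a * (Tr a - 1)\<close> is twice
  the binomial coefficient that accompanies \<open>\<pi> ^ 2\<close>.\<close>

lemma trace_moment:
  fixes Tr :: "'a :: finite_field \<Rightarrow> 'a"
  assumes card: "CARD('a) = p ^ f"
    and Tr: "\<And>a. Tr a = (\<Sum>i<f. a ^ (p ^ i))"
  shows "(\<Sum>a\<in>UNIV - {0}. a ^ m * (Tr a * (Tr a - 1))) =
    of_nat (card (single_sols p f m)) - of_nat (card (pair_sols p f m))"
proof -
  let ?n = "CARD('a) - 1"
  let ?P = "{..<f} \<times> {..<f}"
  have "Tr a * Tr a = (\<Sum>(i, j)\<in>?P. a ^ (p ^ i) * a ^ (p ^ j))" for a
    unfolding Tr sum_product sum.cartesian_product ..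
  then have "a ^ m * (Tr a * Tr a) = (\<Sum>(i, j)\<in>?P. a ^ (m + p ^ i + p ^ j))" for a
    by (simp add: sum_distrib_left power_add mult.assoc case_prod_unfold)
  moreover have "a ^ m * Tr a = (\<Sum>i<f. a ^ (m + p ^ i))" for a
    by (simp add: Tr sum_distrib_left power_add)
  ultimately have "a ^ m * (Tr a * (Tr a - 1)) =
      (\<Sum>(i, j)\<in>?P. a ^ (m + p ^ i + p ^ j)) - (\<Sum>i<f. a ^ (m + p ^ i))" for a
    by (simp add: right_diff_distrib)
  then have "(\<Sum>a\<in>UNIV - {0}. a ^ m * (Tr a * (Tr a - 1))) =
      (\<Sum>(i, j)\<in>?P. \<Sum>a\<in>UNIV - {0}. a ^ (m + p ^ i + p ^ j)) -
      (\<Sum>i<f. \<Sum>a\<in>UNIV - {0}. a ^ (m + p ^ i))"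
    by (simp add: sum_subtractf case_prod_unfold sum.swap[of _ ?P] sum.swap[of _ "{..<f}"])
  also have "(\<Sum>(i, j)\<in>?P. \<Sum>a\<in>UNIV - {0 :: 'a}. a ^ (m + p ^ i + p ^ j)) =
      (\<Sum>(i, j)\<in>?P. if ?n dvd m + p ^ i + p ^ j then - 1 else 0)"
    by (simp only: sum_nonzero_powers)
  also have "\<dots> = (\<Sum>x\<in>pair_sols p f m. - 1)"
    by (rule sum.mono_neutral_cong_right) (auto simp: pair_sols_def card split: if_splits)
  also have "(\<Sum>i<f. \<Sum>a\<in>UNIV - {0 :: 'a}. a ^ (m + p ^ i)) =
      (\<Sum>i<f. if ?n dvd m + p ^ i then - 1 else 0)"
    by (simp only: sum_nonzero_powers)
  also have "\<dots> = (\<Sum>x\<in>single_sols p f m. - 1)"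
    by (rule sum.mono_neutral_cong_right) (auto simp: single_sols_def card split: if_splits)
  finally show ?thesis
    by simp
qed

text \<open>For \<open>i \<le> j\<close> the exact power of \<open>p\<close> in
  \<open>p ^ i + p ^ j\<close> is \<open>p ^ i\<close>; in the case \<open>i = j\<close> this holds
  because \<open>p\<close> does not divide 2.\<close>

lemma odd_prime_power_sum_min:
  fixes p :: nat
  assumes p: "prime p" "odd p" and eq: "p ^ i + p ^ j = p ^ k + p ^ l" and le: "i \<le> j" "k \<le> l"
  shows "k \<le> i"
proof (rule ccontr)
  assume "\<not> k \<le> i"
  then have "p ^ Suc i dvd p ^ k + p ^ l"
    using le by (intro dvd_add le_imp_power_dvd) auto
  then have dvd: "p ^ Suc i dvd p ^ i + p ^ j"
    by (simp only: eq)
  have p1: "p > 1"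
    using p(1) prime_gt_1_nat by blast
  show False
  proof (cases "i = j")
    case True
    with dvd have "p ^ i * p dvd p ^ i * 2"
      by (simp add: mult.commute mult_2)
    then have "p dvd 2"
      using p1 by simp
    then show False
      using p by (metis primes_dvd_imp_eq two_is_prime_nat dvd_refl)
  next
    case False
    with le have "p ^ Suc i dvd p ^ j"
      by (intro le_imp_power_dvd) simp
    with dvd have "p ^ Suc i dvd p ^ i"
      by (simp only: dvd_add_left_iff)
    then show False
      using p1 by (auto dest: dvd_imp_le)
  qed
qed

lemma odd_prime_power_sum_eq:
  fixes p :: nat
  assumes p: "prime p" "odd p" and eq: "p ^ i + p ^ j = p ^ k + p ^ l"
  shows "i = k \<and> j = l \<or> i = l \<and> j = k"
proof -
  have p1: "p > 1"
    using p(1) prime_gt_1_nat by blast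
  have "min i j = min k l"
    using odd_prime_power_sum_min[OF p, of "min i j" "max i j" "min k l" "max k l"]
      odd_prime_power_sum_min[OF p, of "min k l" "max k l" "min i j" "max i j"] eq
    by (auto simp: min_def max_def add.commute split: if_splits)
  then show ?thesis
    using eq p1 by (auto simp: min_def add.commute split: if_splits)
qed

locale odd_prime_power =
  fixes p f :: nat
  assumes p: "prime p" "odd p" and f: "f > 0"
begin

lemma p_ge_3: "p \<ge> 3"
  using p prime_ge_2_nat[of p] by (cases "p = 2") auto

text \<open>Since \<open>p \<ge> 3\<close>, twice \<open>p ^ (f - 1)\<close> stays within the
  modulus \<open>p ^ f - 1\<close>. Congruent sums of two such powers are therefore equal.\<close>

lemma power_sum_le:
  assumes "i < f" "j < f"
  shows "p ^ i + p ^ j \<le> p ^ f - 1"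
proof -
  have "p ^ i \<le> p ^ (f - 1)" "p ^ j \<le> p ^ (f - 1)"
    using assms p_ge_3 by (auto intro!: power_increasing)
  moreover have "p ^ f \<ge> 3 * p ^ (f - 1)"
    using f p_ge_3 by (cases f) auto
  moreover have "p ^ (f - 1) \<ge> 1"
    using p_ge_3 by simp
  ultimately show ?thesis
    by linarith
qed

lemma dvd_add_unique:
  fixes n :: nat
  assumes "n dvd m + u" "n dvd m + v" "0 < u" "u \<le> n" "0 < v" "v \<le> n"
  shows "u = v"
proof -
  have "n dvd (m + u) - (m + v)" "n dvd (m + v) - (m + u)"
    using assms(1,2) dvd_diff_nat by blast+
  then have "n dvd u - v" "n dvd v - u"
    by simp_all
  then show ?thesis
    using assms dvd_imp_le[of n "u - v"] dvd_imp_le[of n "v - u"] by linarith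
qed

lemma pair_sols_unique:
  assumes "(i, j) \<in> pair_sols p f m" "(k, l) \<in> pair_sols p f m"
  shows "i = k \<and> j = l \<or> i = l \<and> j = k"
proof -
  have "p ^ i + p ^ j = p ^ k + p ^ l"
    using assms power_sum_le[of i j] power_sum_le[of k l] p_ge_3
    by (intro dvd_add_unique[of "p ^ f - 1" m]) (auto simp: pair_sols_def add.assoc)
  then show ?thesis
    by (rule odd_prime_power_sum_eq[OF p])
qed

lemma single_sols_unique:
  assumes "i \<in> single_sols p f m" "j \<in> single_sols p f m"
  shows "i = j"
proof -
  have "p ^ i = p ^ j"
    using assms power_sum_le[of i i] power_sum_le[of j j] p_ge_3
    by (intro dvd_add_unique[of "p ^ f - 1" m]) (auto simp: single_sols_def)
  then show ?thesis
    using p_ge_3 by simp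
qed

text \<open>Parity: the modulus is even and powers of \<open>p\<close> are odd, so a single solution
  makes \<open>m\<close> odd and a pair makes it even.\<close>

lemma sols_exclusive:
  assumes "i \<in> single_sols p f m"
  shows "pair_sols p f m = {}"
proof (rule ccontr)
  assume "pair_sols p f m \<noteq> {}"
  then obtain k l where "p ^ f - 1 dvd m + p ^ k + p ^ l"
    by (auto simp: pair_sols_def)
  moreover have "p ^ f - 1 dvd m + p ^ i"
    using assms by (simp add: single_sols_def)
  moreover have "even (p ^ f - 1)"
    using p by simp
  ultimately have "even (m + p ^ k + p ^ l)" "even (m + p ^ i)"
    using dvd_trans by blast+
  then show False
    using p by simp
qed

lemma sols_count_minus_2:
  assumes "p ^ f - 1 dvd m + 2"
  shows "card (pair_sols p f m) = 1" "card (single_sols p f m) = 0"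
proof -
  have 0: "(0, 0) \<in> pair_sols p f m"
    using assms f by (simp add: pair_sols_def)
  then have "pair_sols p f m = {(0, 0)}"
    using pair_sols_unique[of _ _ m 0 0] by auto
  then show "card (pair_sols p f m) = 1"
    by simp
  have "single_sols p f m = {}"
    using 0 sols_exclusive by blast
  then show "card (single_sols p f m) = 0"
    by simp
qed

text \<open>Without a diagonal pair, any pair comes with its swapped copy, so the difference is 0, 2
  or -1. None of these is 1 modulo \<open>p \<ge> 3\<close>.\<close>

lemma sols_count_cong_1:
  assumes "[int (card (pair_sols p f m)) - int (card (single_sols p f m)) = 1] (mod int p)"
  obtains i where "i < f" "p ^ f - 1 dvd m + 2 * p ^ i"
proof -
  let ?P = "pair_sols p f m" and ?L = "single_sols p f m"
  have "\<exists>i. (i, i) \<in> ?P"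
  proof (rule ccontr)
    assume diag: "\<not> ?thesis"
    have "card ?P = 0 \<or> card ?P = 2"
    proof (cases "?P = {}")
      case False
      then obtain i j where ij: "(i, j) \<in> ?P"
        by auto
      then have "(j, i) \<in> ?P"
        by (auto simp: pair_sols_def add_ac)
      then have "?P = {(i, j), (j, i)}"
        using ij pair_sols_unique[of _ _ m i j] by auto
      moreover have "i \<noteq> j"
        using diag ij by blast
      ultimately show ?thesis
        by simp
    qed simp
    moreover have "card ?L = 0 \<or> card ?L = 1 \<and> card ?P = 0"
    proof (cases "?L = {}")
      case False
      then obtain i where i: "i \<in> ?L"
        by auto
      then have "?L = {i}"
        using single_sols_unique by blast
      with sols_exclusive[OF i] show ?thesis
        by simp
    qed simp
    ultimately have "int (card ?P) - int (card ?L) \<in> {0, 2, -1}"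
      by auto
    moreover have "\<bar>x - 1\<bar> < int p" if "x \<in> {0, 2, - 1 :: int}" for x
      using that p_ge_3 by auto
    ultimately have "\<bar>int (card ?P) - int (card ?L) - 1\<bar> < int p" "int (card ?P) - int (card ?L) \<noteq> 1"
      by auto
    then show False
      using assms zdvd_imp_le[of "int p" "\<bar>int (card ?P) - int (card ?L) - 1\<bar>"]
      by (auto simp: cong_iff_dvd_diff)
  qed
  then show ?thesis
    using that by (auto simp: pair_sols_def mult_2 add.assoc)
qed

end

subsection \<open>Reduction to the finite field\<close>

text \<open>The same integer polynomial is evaluated at \<open>\<eta>\<close> in \<open>A\<close>
  and at \<open>g\<close> in the finite field. This takes the place of a residue map.\<close>

definition ev :: "int poly \<Rightarrow> 'b :: comm_ring_1 \<Rightarrow> 'b" where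
  "ev P x = poly (map_poly of_int P) x"

lemma ev_add: "ev (P + Q) x = ev P x + ev Q x"
  by (simp add: ev_def of_int_poly_hom.hom_add)

lemma ev_diff: "ev (P - Q) x = ev P x - ev Q x"
  by (simp add: ev_def of_int_poly_hom.hom_minus)

lemma ev_mult: "ev (P * Q) x = ev P x * ev Q x"
  by (simp add: ev_def of_int_poly_hom.hom_mult)

lemma ev_1: "ev 1 x = 1"
  by (simp add: ev_def)

lemma ev_power: "ev (P ^ k) x = ev P x ^ k"
  by (induction k) (simp_all add: ev_1 ev_mult)

lemma ev_sum: "ev (sum P S) x = (\<Sum>i\<in>S. ev (P i) x)"
  by (induction S rule: infinite_finite_induct) (simp_all add: ev_add, simp_all add: ev_def)

lemma ev_monom: "ev (monom c k) x = of_int c * x ^ k"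
  by (simp add: ev_def map_poly_monom poly_monom)

lemma ev_altdef: "ev P x = (\<Sum>j\<le>degree P. of_int (coeff P j) * x ^ j)"
proof -
  have "ev P x = ev (\<Sum>j\<le>degree P. monom (coeff P j) j) x"
    by (simp add: poly_as_sum_of_monoms)
  then show ?thesis
    by (simp add: ev_sum ev_monom)
qed

section \<open>Primitive roots in the complex numbers and in finite fields\<close>

definition primitive_root :: "nat \<Rightarrow> 'b :: monoid_mult \<Rightarrow> bool" where
  "primitive_root n g \<longleftrightarrow> g ^ n = 1 \<and> (\<forall>d. 0 < d \<longrightarrow> d < n \<longrightarrow> g ^ d \<noteq> 1)"

lemma primitive_root_power_eq_1_iff:
  assumes "primitive_root n g" "n > 0"
  shows "g ^ k = 1 \<longleftrightarrow> n dvd k"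
proof -
  have "g ^ k = g ^ (n * (k div n) + k mod n)"
    by simp
  also have "\<dots> = g ^ (k mod n)"
    using assms(1) by (simp only: power_add power_mult) (simp add: primitive_root_def)
  finally have *: "g ^ k = g ^ (k mod n)" .
  show ?thesis
  proof
    assume "g ^ k = 1"
    with * assms show "n dvd k"
      by (auto simp: primitive_root_def dvd_eq_mod_eq_0)
  qed (use * in \<open>simp add: dvd_eq_mod_eq_0\<close>)
qed

lemma primitive_root_power_eq_iff:
  fixes g :: "'b :: field"
  assumes "primitive_root n g" "n > 0"
  shows "g ^ k = g ^ l \<longleftrightarrow> [k = l] (mod n)"
proof -
  have g0: "g \<noteq> 0"
    using assms by (auto simp: primitive_root_def power_0_left)
  have *: "g ^ k = g ^ l \<longleftrightarrow> [k = l] (mod n)" if "k \<le> l" for k l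
  proof -
    have "g ^ l = g ^ k * g ^ (l - k)"
      using that by (simp flip: power_add)
    then have "g ^ k = g ^ l \<longleftrightarrow> g ^ (l - k) = 1"
      using g0 by auto
    also have "\<dots> \<longleftrightarrow> [k = l] (mod n)"
      unfolding primitive_root_power_eq_1_iff[OF assms] using that
      by (metis cong_altdef_nat cong_sym_eq)
    finally show ?thesis .
  qed
  show ?thesis
    using *[of k l] *[of l k] by (metis cong_sym_eq nat_le_linear)
qed

lemma complex_primitive_root:
  assumes n: "n > 0"
  obtains \<eta> :: complex where "primitive_root n \<eta>" "roots_of_unity n = range (\<lambda>k. \<eta> ^ k)"
proof -
  define \<eta> where "\<eta> = cis (2 * pi / real n)"
  have pow: "\<eta> ^ k = cis (2 * pi * real k / real n)" for k
    by (simp add: \<eta>_def DeMoivre mult_ac)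
  have bij: "bij_betw (\<lambda>k. \<eta> ^ k) {..<n} (roots_of_unity n)"
    unfolding pow roots_of_unity_def using bij_betw_roots_unity[OF n] .
  have \<eta>n: "\<eta> ^ n = 1"
    unfolding pow using n by simp
  have "\<eta> ^ d \<noteq> 1" if "0 < d" "d < n" for d
    using bij_betw_imp_inj_on[OF bij] that n by (auto dest: inj_onD[of _ _ d 0])
  with \<eta>n have "primitive_root n \<eta>"
    by (simp add: primitive_root_def)
  moreover have "\<eta> \<in> roots_of_unity n"
    by (simp add: roots_of_unity_def \<eta>n)
  then have "roots_of_unity n = range (\<lambda>k. \<eta> ^ k)"
    using bij_betw_imp_surj_on[OF bij] roots_of_unity_power by blast
  ultimately show ?thesis
    by (rule that)
qed

lemma primitive_root_generates:
  fixes g :: "'a :: finite_field"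
  assumes g: "primitive_root (CARD('a) - 1) g" and "a \<noteq> 0"
  obtains i where "a = g ^ i"
proof -
  let ?n = "CARD('a) - 1"
  have n: "?n > 0"
    using CARD_field_gt_1[where 'a = 'a] by simp
  have "inj_on (\<lambda>i. g ^ i) {..<?n}"
    by (rule inj_onI) (auto simp: primitive_root_power_eq_iff[OF g n] cong_def)
  then have "card ((\<lambda>i. g ^ i) ` {..<?n}) = card (UNIV - {0 :: 'a})"
    by (simp add: card_image card_Diff_subset)
  moreover have "g \<noteq> 0"
    using g n by (auto simp: primitive_root_def power_0_left)
  ultimately have "(\<lambda>i. g ^ i) ` {..<?n} = UNIV - {0}"
    by (intro card_subset_eq) auto
  then show ?thesis
    using assms(2) that by blast
qed

context cyclotomic
begin

lemma A_ev: "x \<in> A \<Longrightarrow> ev P x \<in> A"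
  unfolding ev_def by (rule A_poly)

text \<open>Modulo X^n - 1 with \<open>n = CARD('a) - 1\<close>, which has \<open>\<eta>\<close> as
  a root, \<open>P\<close> reduces to the polynomial with coefficients \<open>C s\<close>. Vanishing
  on the field makes each of them divisible by the characteristic.\<close>

lemma ev_in_I_of_vanishing:
  assumes \<eta>: "\<eta> \<in> A" "\<eta> ^ (CARD('a) - 1) = 1"
    and zero: "\<And>a :: 'a :: finite_field. a \<noteq> 0 \<Longrightarrow> ev P a = 0"
  shows "ev P \<eta> \<in> I (of_nat CHAR('a))"
proof -
  define n where "n = CARD('a) - 1"
  have n: "n > 0"
    using CARD_field_gt_1[where 'a = 'a] by (simp add: n_def)
  define J where "J s = {j \<in> {..degree P}. j mod n = s}" for s
  define C where "C s = (\<Sum>j\<in>J s. coeff P j)" for s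
  have dvd: "int CHAR('a) dvd C s" if s: "s < n" for s
  proof -
    have iff: "n dvd j + (n - s) \<longleftrightarrow> j mod n = s" for j
    proof -
      have "n dvd j + (n - s) \<longleftrightarrow> [j + (n - s) = s + (n - s)] (mod n)"
        using s by (simp add: cong_def dvd_eq_mod_eq_0)
      also have "\<dots> \<longleftrightarrow> j mod n = s"
        using s by (simp only: cong_add_rcancel_nat) (simp add: cong_def)
      finally show ?thesis .
    qed
    \<comment> \<open>Finite Fourier inversion: summing with weight \<open>a ^ (n - s)\<close>
      isolates the exponents congruent to \<open>s\<close>.\<close>
    have "0 = (\<Sum>a\<in>UNIV - {0 :: 'a}. a ^ (n - s) * ev P a)"
      by (rule sum.neutral[symmetric]) (simp add: zero)
    also have "\<dots> = (\<Sum>a\<in>UNIV - {0 :: 'a}. \<Sum>j\<le>degree P. of_int (coeff P j) * a ^ (j + (n - s)))"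
      by (simp add: ev_altdef sum_distrib_left power_add mult_ac)
    also have "\<dots> = (\<Sum>j\<le>degree P. of_int (coeff P j) * (\<Sum>a\<in>UNIV - {0 :: 'a}. a ^ (j + (n - s))))"
      by (subst sum.swap) (simp add: sum_distrib_left)
    also have "\<dots> = (\<Sum>j\<le>degree P. of_int (coeff P j) * (if j mod n = s then - 1 else 0))"
      by (simp only: sum_nonzero_powers iff flip: n_def)
    also have "\<dots> = (\<Sum>j\<in>J s. - of_int (coeff P j))"
      by (rule sum.mono_neutral_cong_right) (auto simp: J_def)
    also have "\<dots> = - of_int (C s)"
      by (simp add: C_def sum_negf)
    finally have "of_int (C s) = (0 :: 'a)"
      by simp
    then show ?thesis
      by (simp add: of_int_eq_0_iff_char_dvd)
  qed
  have "\<eta> ^ j = \<eta> ^ (j mod n)" for j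
  proof -
    have "\<eta> ^ j = \<eta> ^ (n * (j div n) + j mod n)"
      by simp
    also have "\<dots> = \<eta> ^ (j mod n)"
      using \<eta>(2) by (simp only: power_add power_mult n_def power_one mult_1_left)
    finally show ?thesis .
  qed
  then have "ev P \<eta> = (\<Sum>j\<le>degree P. of_int (coeff P j) * \<eta> ^ (j mod n))"
    unfolding ev_altdef by (metis (no_types, lifting))
  also have "\<dots> = (\<Sum>s<n. \<Sum>j\<in>J s. of_int (coeff P j) * \<eta> ^ (j mod n))"
    unfolding J_def using n by (intro sum.group[symmetric]) auto
  also have "\<dots> = (\<Sum>s<n. \<eta> ^ s * of_int (C s))"
    unfolding C_def of_int_sum sum_distrib_left by (intro sum.cong) (auto simp: J_def)
  also have "\<dots> \<in> I (of_nat CHAR('a))"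
  proof (intro I_sum I_mult2 A_power \<eta>)
    fix s assume "s \<in> {..<n}"
    then obtain k where "C s = int CHAR('a) * k"
      using dvd by (auto elim: dvdE)
    then show "of_int (C s) \<in> I (of_nat CHAR('a))"
      by (auto intro: I_I A_of_int)
  qed
  finally show ?thesis .
qed

text \<open>Reduction modulo a prime above \<open>I d\<close>: it sends \<open>\<eta>\<close> to \<open>g\<close>.\<close>

lemma common_root:
  assumes \<eta>: "\<eta> \<in> A" "\<eta> ^ (CARD('a) - 1) = 1"
    and d: "of_nat CHAR('a) \<in> I d" "1 \<notin> I d"
  obtains g :: "'a :: finite_field"
  where "g \<noteq> 0" "\<And>P. ev P \<eta> \<in> I d \<Longrightarrow> ev P g = 0"
proof -
  define n where "n = CARD('a) - 1"
  have n: "n > 0"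
    using CARD_field_gt_1[where 'a = 'a] by (simp add: n_def)
  have "\<exists>g :: 'a. g \<noteq> 0 \<and> (\<forall>P. ev P \<eta> \<in> I d \<longrightarrow> ev P g = 0)"
  proof (rule ccontr)
    assume "\<not> ?thesis"
    then have ex: "\<exists>P. ev P \<eta> \<in> I d \<and> ev P g \<noteq> 0" if "g \<noteq> 0" for g :: 'a
      using that by blast
    \<comment> \<open>Polynomials that are nonzero at single points are merged, one point at a time,
      into one that is nonzero on all of \<open>S\<close>.\<close>
    have "\<exists>P. ev P \<eta> \<in> I d \<and> (\<forall>g\<in>S. ev P g \<noteq> 0)" if "finite S" "S \<subseteq> UNIV - {0}" for S :: "'a set"
      using that
    proof (induction S)
      case empty
      then show ?case
        by (auto intro!: exI[of _ 0] simp: ev_def I_0)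
    next
      case (insert g S)
      then obtain P where P: "ev P \<eta> \<in> I d" "\<And>h. h \<in> S \<Longrightarrow> ev P h \<noteq> 0"
        by auto
      obtain Q where Q: "ev Q \<eta> \<in> I d" "ev Q g \<noteq> 0"
        using ex insert.prems by blast
      show ?case
      proof (cases "ev P g = 0")
        case True
        \<comment> \<open>Where \<open>P\<close> is nonzero, \<open>P ^ n\<close> is 1 and
          \<open>?R\<close> agrees with \<open>P\<close>; at the zero \<open>g\<close> of
          \<open>P\<close> it agrees with \<open>Q\<close>.\<close>
        let ?R = "P + (1 - P ^ n) * Q"
        have "ev ?R \<eta> \<in> I d"
          unfolding ev_add ev_mult using P(1) Q(1) \<eta> by (intro I_add I_mult2 A_ev)
        moreover have "ev ?R h \<noteq> 0" if "h \<in> insert g S" for h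
        proof (cases "h = g")
          case False
          with that have "ev P h \<noteq> 0"
            using P by auto
          then show ?thesis
            using power_CARD_minus_1[of "ev P h"] by (simp add: ev_add ev_mult ev_diff ev_power ev_1 n_def)
        qed (use True Q n in \<open>simp add: ev_add ev_mult ev_diff ev_power ev_1 power_0_left\<close>)
        ultimately show ?thesis
          by blast
      qed (use P in auto)
    qed
    from this[of "UNIV - {0}"] obtain P
      where P: "ev P \<eta> \<in> I d" "\<And>g :: 'a. g \<noteq> 0 \<Longrightarrow> ev P g \<noteq> 0"
      by auto
    \<comment> \<open>\<open>P ^ n - 1\<close> vanishes at all nonzero points, so its value at
      \<open>\<eta>\<close> lies in \<open>I d\<close>, as does that of \<open>P ^ n\<close>. This
      puts 1 into \<open>I d\<close>.\<close>
    have "ev (P ^ n - 1) \<eta> \<in> I (of_nat CHAR('a))"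
      using power_CARD_minus_1[where 'a = 'a] P(2)
      by (intro ev_in_I_of_vanishing \<eta>) (simp add: ev_diff ev_power ev_1 n_def)
    then have "ev P \<eta> ^ n - 1 \<in> I d"
      using d(1) I_trans by (simp add: ev_diff ev_power ev_1)
    moreover have "ev P \<eta> ^ n \<in> I d"
      using n P(1) \<eta> by (cases n) (auto intro!: I_mult A_power A_ev)
    ultimately have "ev P \<eta> ^ n - (ev P \<eta> ^ n - 1) \<in> I d"
      by (rule I_diff[rotated])
    with d(2) show False
      by simp
  qed
  with that show ?thesis
    by blast
qed

text \<open>If the order of \<open>g\<close> were smaller than \<open>n = CARD('a) - 1\<close>, then
  \<open>g ^ r = 1\<close> for a proper divisor \<open>r\<close> of \<open>n\<close>. The polynomial
  (X^n - 1) / (X^r - 1) vanishes at \<open>\<eta>\<close>, hence at \<open>g\<close>, where its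
  value is \<open>n / r\<close>; but \<open>n\<close> is -1 in the field.\<close>

lemma common_root_primitive:
  fixes g :: "'a :: finite_field"
  assumes \<eta>: "primitive_root (CARD('a) - 1) \<eta>"
    and g: "g \<noteq> 0" "\<And>P. ev P \<eta> \<in> I d \<Longrightarrow> ev P g = 0"
  shows "primitive_root (CARD('a) - 1) g"
proof -
  define n where "n = CARD('a) - 1"
  have gn: "g ^ n = 1"
    unfolding n_def using g(1) by (rule power_CARD_minus_1)
  have False if e: "0 < e" "e < n" "g ^ e = 1" for e
  proof -
    define r where "r = gcd e n"
    obtain x y where "e * x = n * y + r"
      using bezout_nat[of e n] e(1) by (auto simp: r_def)
    then have "(g ^ e) ^ x = (g ^ n) ^ y * g ^ r"
      by (metis power_add power_mult)
    then have gr: "g ^ r = 1"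
      using gn e by simp
    have r: "0 < r" "r < n" "r dvd n"
      using e by (auto simp: r_def intro: le_less_trans[OF gcd_le1_nat])
    obtain m where m: "n = r * m"
      using r(3) ..
    define P :: "int poly" where "P = (\<Sum>j<m. monom 1 (r * j))"
    have "(\<eta> ^ r) ^ m = 1"
      using \<eta>[folded n_def] by (simp add: primitive_root_def flip: m power_mult)
    moreover have "ev P \<eta> = (\<Sum>j<m. (\<eta> ^ r) ^ j)"
      by (simp add: P_def ev_sum ev_monom power_mult)
    ultimately have "(\<eta> ^ r - 1) * ev P \<eta> = 0"
      using power_diff_1_eq[of "\<eta> ^ r" m] by simp
    moreover have "\<eta> ^ r \<noteq> 1"
      using \<eta> r by (simp add: primitive_root_def n_def)
    ultimately have "ev P \<eta> = 0"
      by simp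
    then have "ev P g = 0"
      by (intro g) (simp add: I_0)
    then have "of_nat m = (0 :: 'a)"
      by (simp add: P_def ev_sum ev_monom power_mult gr)
    then have "of_nat n = (0 :: 'a)"
      by (simp add: m)
    then show False
      using of_nat_CARD_minus_1[where 'a = 'a] by (simp add: n_def)
  qed
  with gn show ?thesis
    unfolding primitive_root_def n_def by blast
qed

end

subsection \<open>Expansion in powers of the uniformizer\<close>

context cyclotomic
begin

lemma frob_power_fixed:
  assumes "prime l" "x \<in> A" "x ^ l - x \<in> I (of_nat l)"
  shows "x ^ (l ^ k) - x \<in> I (of_nat l)"
proof (induction k)
  case (Suc k)
  have "(x ^ (l ^ k)) ^ l - x ^ l \<in> I (of_nat l)"
    using assms Suc by (intro I_power_diff A_power)
  then have "(x ^ (l ^ k)) ^ l - x \<in> I (of_nat l)"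
    using assms(3) by (rule I_diff_trans)
  then show ?case
    by (simp add: mult.commute[of l] power_mult)
qed (simp add: I_0)

text \<open>The power \<open>l ^ k\<close> is additive modulo \<open>l\<close>, so its fixed points
  modulo \<open>l\<close> are closed under sums.\<close>

lemma frob_fixed_sum:
  assumes l: "prime l" and "finite S"
    and "\<And>i. i \<in> S \<Longrightarrow> x i \<in> A" "\<And>i. i \<in> S \<Longrightarrow> x i ^ (l ^ k) - x i \<in> I (of_nat l)"
  shows "(\<Sum>i\<in>S. x i) ^ (l ^ k) - (\<Sum>i\<in>S. x i) \<in> I (of_nat l)"
  using assms(2,3,4)
proof (induction S)
  case empty
  then show ?case
    using l by (simp add: I_0 prime_gt_0_nat power_0_left)
next
  case (insert i S)
  let ?s = "sum x S" and ?q = "l ^ k"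
  have "(x i + ?s) ^ ?q - (x i ^ ?q + ?s ^ ?q) \<in> I (of_nat l)"
    using insert by (intro frob_add_power l) (auto intro: A_sum)
  moreover have "(x i ^ ?q - x i) + (?s ^ ?q - ?s) \<in> I (of_nat l)"
    using insert by (intro I_add) auto
  then have "(x i ^ ?q + ?s ^ ?q) - (x i + ?s) \<in> I (of_nat l)"
    by (simp add: algebra_simps)
  ultimately have "(x i + ?s) ^ ?q - (x i + ?s) \<in> I (of_nat l)"
    by (rule I_diff_trans)
  with insert show ?case
    by simp
qed

lemma frob_fixed_int_mult_root:
  assumes l: "prime l" and r: "r \<in> roots_of_unity N" "r ^ (l ^ k) = r"
  shows "(of_int c * r) ^ (l ^ k) - of_int c * r \<in> I (of_nat l)"
proof -
  have "(of_int c ^ (l ^ k) - of_int c) * r \<in> I (of_nat l)"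
    using assms by (intro I_mult frob_power_fixed fermat_int A_of_int A_root)
  then show ?thesis
    using r by (simp add: power_mult_distrib algebra_simps)
qed

end

lemma sum_lessThan_odd:
  fixes p :: nat
  assumes "odd p"
  shows "(\<Sum>t<p. t) = p * ((p - 1) div 2)"
proof -
  have *: "(\<Sum>t<Suc (2 * k). t) = Suc (2 * k) * k" for k :: nat
    by (induction k) auto
  obtain k where "p = 2 * k + 1"
    using assms by (rule oddE)
  then have k: "p = Suc (2 * k)"
    by (simp only: Suc_eq_plus1)
  have "(Suc (2 * k) - 1) div 2 = k"
    by simp
  then show ?thesis
    by (simp only: k *)
qed

section \<open>The prime \<open>p\<close> and the uniformizer \<open>\<pi>\<close>\<close>

locale cyclotomic_prime = cyclotomic +
  fixes p :: nat and \<zeta> :: complex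
  assumes p: "prime p" "odd p" and p_dvd_N: "p dvd N"
    and \<zeta>: "\<zeta> ^ p = 1" "\<zeta> \<noteq> 1"
begin

abbreviation \<pi> where "\<pi> \<equiv> \<zeta> - 1"

lemma \<zeta>_root: "\<zeta> \<in> roots_of_unity N"
  using \<zeta>(1) p_dvd_N by (auto simp: roots_of_unity_def power_mult elim!: dvdE)

lemma \<zeta>_A: "\<zeta> \<in> A"
  by (intro A_root \<zeta>_root)

lemma \<pi>_A: "\<pi> \<in> A"
  by (intro A_diff A_1 \<zeta>_A)

lemma \<pi>_nonzero: "\<pi> \<noteq> 0"
  using \<zeta>(2) by simp

lemma \<zeta>_expansion:
  obtains w where "w \<in> A"
    "\<zeta> ^ t = 1 + of_nat t * \<pi> + of_nat (t choose 2) * \<pi> ^ 2 + \<pi> ^ 3 * w"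
proof -
  have "\<exists>w\<in>A. \<zeta> ^ t = 1 + of_nat t * \<pi> + of_nat (t choose 2) * \<pi> ^ 2 + \<pi> ^ 3 * w"
  proof (induction t)
    case 0
    show ?case
      using A_0 by (intro bexI[of _ 0]) auto
  next
    case (Suc t)
    then obtain w where w: "w \<in> A"
      "\<zeta> ^ t = 1 + of_nat t * \<pi> + of_nat (t choose 2) * \<pi> ^ 2 + \<pi> ^ 3 * w"
      by blast
    have C: "Suc t choose 2 = t + (t choose 2)"
      by (simp add: numeral_2_eq_2)
    have "\<zeta> ^ Suc t = \<zeta> ^ t * (1 + \<pi>)"
      by simp
    also have "\<dots> = 1 + of_nat (Suc t) * \<pi> + of_nat (Suc t choose 2) * \<pi> ^ 2 +
        \<pi> ^ 3 * (w + of_nat (t choose 2) + \<pi> * w)"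
      unfolding w(2) C by (simp add: algebra_simps power2_eq_square power3_eq_cube)
    finally show ?case
      using w(1) by (intro bexI[of _ "w + of_nat (t choose 2) + \<pi> * w"]) (auto intro: A_intros \<pi>_A)
  qed
  then show ?thesis
    using that by blast
qed

text \<open>Expand the vanishing sum of the powers of \<open>\<zeta>\<close>: the constant term is
  \<open>p\<close>, and for odd \<open>p\<close> the linear coefficient is a multiple of
  \<open>p\<close>.\<close>

lemma p_in_I_\<pi>_sq: "of_nat p \<in> I (\<pi> ^ 2)"
proof -
  have "\<exists>w\<in>A. \<zeta> ^ t = 1 + of_nat t * \<pi> + \<pi> ^ 2 * w" for t
  proof -
    obtain w where "w \<in> A"
      "\<zeta> ^ t = 1 + of_nat t * \<pi> + of_nat (t choose 2) * \<pi> ^ 2 + \<pi> ^ 3 * w"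
      by (rule \<zeta>_expansion)
    then show ?thesis
      by (intro bexI[of _ "of_nat (t choose 2) + \<pi> * w"])
         (auto intro: A_intros \<pi>_A simp: distrib_left power2_eq_square power3_eq_cube mult_ac)
  qed
  then obtain w where w: "\<And>t. w t \<in> A" "\<And>t. \<zeta> ^ t = 1 + of_nat t * \<pi> + \<pi> ^ 2 * w t"
    by metis
  define k where "k = (p - 1) div 2"
  define W where "W = (\<Sum>t<p. w t)"
  have W: "W \<in> A"
    unfolding W_def by (intro A_sum w)
  have "\<pi> * (\<Sum>t<p. \<zeta> ^ t) = 0"
    using power_diff_1_eq[of \<zeta> p] \<zeta>(1) by simp
  then have "0 = (\<Sum>t<p. \<zeta> ^ t)"
    using \<pi>_nonzero by simp
  also have "\<dots> = (\<Sum>t<p. 1 + of_nat t * \<pi> + \<pi> ^ 2 * w t)"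
    by (intro sum.cong refl w)
  also have "\<dots> = of_nat p + (\<Sum>t<p. of_nat t) * \<pi> + \<pi> ^ 2 * W"
    by (simp add: sum.distrib W_def sum_distrib_left sum_distrib_right)
  also have "(\<Sum>t<p. of_nat t) = (of_nat (\<Sum>t<p. t) :: complex)"
    by simp
  also have "\<dots> = of_nat p * of_nat k"
    by (simp only: sum_lessThan_odd[OF p(2)] k_def of_nat_mult)
  finally have eq: "of_nat p + of_nat p * of_nat k * \<pi> + \<pi> ^ 2 * W = 0"
    by simp
  \<comment> \<open>First \<open>p\<close> is seen to be a multiple of \<open>\<pi>\<close>;
    inserting this into the linear term \<open>p * k * \<pi>\<close> produces a second factor
    \<open>\<pi>\<close>.\<close>
  let ?v = "- (of_nat p * of_nat k + \<pi> * W)"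
  have v: "of_nat p = \<pi> * ?v"
    using eq by (simp add: algebra_simps power2_eq_square add_eq_0_iff)
  have "of_nat p = \<pi> ^ 2 * - W - of_nat p * (of_nat k * \<pi>)"
    using eq by (simp add: algebra_simps add_eq_0_iff)
  also have "\<dots> = \<pi> ^ 2 * - W - (\<pi> * ?v) * (of_nat k * \<pi>)"
    by (simp only: v[symmetric])
  also have "\<dots> = \<pi> ^ 2 * (- W - ?v * of_nat k)"
    by (simp add: algebra_simps power2_eq_square)
  also have "\<dots> \<in> I (\<pi> ^ 2)"
    by (intro I_I A_intros W \<pi>_A)
  finally show ?thesis .
qed

lemma I_\<pi>_sq_subset: "x \<in> I (\<pi> ^ 2) \<Longrightarrow> x \<in> I \<pi>"
  by (erule I_trans) (simp add: power2_eq_square I_I \<pi>_A)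

lemma p_in_I_\<pi>: "of_nat p \<in> I \<pi>"
  by (rule I_\<pi>_sq_subset[OF p_in_I_\<pi>_sq])

text \<open>\<open>\<pi> ^ p\<close> is congruent to \<open>\<zeta> ^ p - 1 = 0\<close> modulo
  \<open>p\<close>, so an inverse of \<open>\<pi>\<close> in \<open>A\<close> would make 1 divisible
  by \<open>p\<close>.\<close>

lemma one_notin_I_\<pi>: "1 \<notin> I \<pi>"
proof
  assume "1 \<in> I \<pi>"
  then obtain w where w: "w \<in> A" "1 = \<pi> * w"
    by (auto simp: cyc_ideal_def)
  have "(\<zeta> + - 1) ^ p - (\<zeta> ^ p + (- 1) ^ p) \<in> I (of_nat p)"
    by (intro frob_add p \<zeta>_A A_uminus A_1)
  then have "\<pi> ^ p \<in> I (of_nat p)"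
    using \<zeta>(1) p(2) by simp
  then have "\<pi> ^ p * w ^ p \<in> I (of_nat p)"
    using w by (intro I_mult A_power)
  moreover have "\<pi> ^ p * w ^ p = 1"
    using w(2) by (metis power_mult_distrib power_one)
  ultimately have "of_int 1 \<in> I (of_int (int p))"
    by simp
  then have "int p dvd 1"
    by (rule of_int_in_I)
  then show False
    using p(1) prime_gt_1_nat[OF p(1)] by simp
qed

text \<open>The expansion of the sum in powers of \<open>\<pi>\<close> gives only \<open>D1 \<in> I \<pi>\<close> at first; since \<open>D1\<close> is a
  fixed point of a power of Frobenius modulo \<open>p\<close>, it even lies in \<open>I (\<pi> ^ 2)\<close>.\<close>

lemma second_coefficient:
  assumes S: "finite S" and x: "\<And>a. a \<in> S \<Longrightarrow> x a \<in> A"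
    and zero: "(\<Sum>a\<in>S. x a * \<zeta> ^ t a) = 0" "(\<Sum>a\<in>S. x a) = 0"
    and k: "k > 0"
    and frob: "(\<Sum>a\<in>S. x a * of_nat (t a)) ^ (p ^ k) - (\<Sum>a\<in>S. x a * of_nat (t a)) \<in> I (of_nat p)"
  shows "(\<Sum>a\<in>S. x a * of_nat (t a choose 2)) \<in> I \<pi>"
proof -
  have "\<exists>w\<in>A. \<zeta> ^ t = 1 + of_nat t * \<pi> + of_nat (t choose 2) * \<pi> ^ 2 + \<pi> ^ 3 * w" for t
    using \<zeta>_expansion by metis
  then obtain w where w: "\<And>t. w t \<in> A"
    "\<And>t. \<zeta> ^ t = 1 + of_nat t * \<pi> + of_nat (t choose 2) * \<pi> ^ 2 + \<pi> ^ 3 * w t"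
    by metis
  define D1 where "D1 = (\<Sum>a\<in>S. x a * of_nat (t a))"
  define D2 where "D2 = (\<Sum>a\<in>S. x a * of_nat (t a choose 2))"
  define W where "W = (\<Sum>a\<in>S. x a * w (t a))"
  have D2: "D2 \<in> A" and W: "W \<in> A" and D1: "D1 \<in> A"
    unfolding D1_def D2_def W_def by (intro A_sum A_mult x w A_of_nat; assumption)+
  have "0 = (\<Sum>a\<in>S. x a * (1 + of_nat (t a) * \<pi> + of_nat (t a choose 2) * \<pi> ^ 2 + \<pi> ^ 3 * w (t a)))"
    unfolding zero(1)[symmetric] by (intro sum.cong refl arg_cong2[of _ _ _ _ "(*)"] w)
  also have "\<dots> = (\<Sum>a\<in>S. x a) + D1 * \<pi> + D2 * \<pi> ^ 2 + \<pi> ^ 3 * W"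
    unfolding D1_def D2_def W_def sum_distrib_left sum_distrib_right sum.distrib[symmetric]
    by (intro sum.cong) (auto simp: algebra_simps)
  finally have "\<pi> * (D1 + \<pi> * D2 + \<pi> ^ 2 * W) = 0"
    using zero(2) by (simp add: algebra_simps power2_eq_square power3_eq_cube)
  then have eq: "D1 + \<pi> * D2 + \<pi> ^ 2 * W = 0"
    using \<pi>_nonzero by simp
  then have D1_eq: "D1 = \<pi> * - (D2 + \<pi> * W)"
    by (simp add: algebra_simps power2_eq_square add_eq_0_iff)
  \<comment> \<open>As a multiple of \<open>\<pi>\<close>, \<open>D1\<close> has its power with
    exponent \<open>p ^ k \<ge> 2\<close> in \<open>I (\<pi> ^ 2)\<close>. The Frobenius congruence
    modulo \<open>p\<close>, which is itself in \<open>I (\<pi> ^ 2)\<close>, transfers this to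
    \<open>D1\<close>.\<close>
  have "p ^ k \<ge> 2"
    using p(1) k prime_ge_2_nat[OF p(1)] self_le_power[of p k] by linarith
  then obtain r where r: "p ^ k = 2 + r"
    using le_Suc_ex by blast
  have "D1 ^ (p ^ k) = \<pi> ^ 2 * (- (D2 + \<pi> * W)) ^ 2 * D1 ^ r"
    unfolding r power_add by (subst (1) D1_eq) (simp only: power_mult_distrib)
  also have "\<dots> \<in> I (\<pi> ^ 2)"
    by (intro I_mult I_I A_intros \<pi>_A D1 D2 W)
  finally have "D1 ^ (p ^ k) \<in> I (\<pi> ^ 2)" .
  moreover have "D1 ^ (p ^ k) - D1 \<in> I (\<pi> ^ 2)"
    using frob[folded D1_def] p_in_I_\<pi>_sq by (rule I_trans)
  ultimately have "D1 ^ (p ^ k) - (D1 ^ (p ^ k) - D1) \<in> I (\<pi> ^ 2)"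
    by (rule I_diff)
  then obtain v where v: "v \<in> A" "D1 = \<pi> ^ 2 * v"
    by (auto simp: cyc_ideal_def)
  \<comment> \<open>With \<open>D1\<close> divisible by \<open>\<pi> ^ 2\<close> a further factor
    \<open>\<pi>\<close> cancels.\<close>
  have "\<pi> * (D2 + \<pi> * (v + W)) = 0"
    using eq unfolding v(2) by (simp add: algebra_simps power2_eq_square)
  then have "D2 + \<pi> * (v + W) = 0"
    using \<pi>_nonzero by simp
  then have "D2 = \<pi> * - (v + W)"
    unfolding mult_minus_right by (simp only: eq_neg_iff_add_eq_0)
  also have "\<dots> \<in> I \<pi>"
    by (intro I_I A_intros v W)
  finally show ?thesis
    by (simp only: D2_def)
qed

end


subsection \<open>Multiplicative characters and Gauss sums\<close>

lemma mult_char_value: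
  assumes "mult_char (\<chi> :: 'a :: finite_field \<Rightarrow> complex)" "a \<noteq> 0"
  shows "\<chi> a \<in> roots_of_unity (CARD('a) - 1)" "\<chi> a ^ (CARD('a) - 1) = 1"
  using assms by (auto simp: mult_char_def roots_of_unity_def)

lemma mult_char_nonzero:
  assumes "mult_char (\<chi> :: 'a :: finite_field \<Rightarrow> complex)" "a \<noteq> 0"
  shows "\<chi> a \<noteq> 0"
  using mult_char_value[OF assms] CARD_field_gt_1[where 'a = 'a]
  by (intro roots_of_unity_nonzero[of "CARD('a) - 1"]) auto

lemma mult_char_1:
  assumes "mult_char \<chi>"
  shows "\<chi> 1 = 1"
proof -
  have "\<chi> 1 * \<chi> 1 = \<chi> 1 * 1"
    using assms unfolding mult_char_def by (metis mult_1 mult.right_neutral zero_neq_one)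
  then show ?thesis
    using mult_char_nonzero[OF assms, of 1] by simp
qed

lemma mult_char_power:
  assumes "mult_char \<chi>" "a \<noteq> 0"
  shows "\<chi> (a ^ k) = \<chi> a ^ k"
proof (induction k)
  case (Suc k)
  have "\<chi> (a * a ^ k) = \<chi> a * \<chi> (a ^ k)"
    using assms unfolding mult_char_def by simp
  with Suc show ?case
    by simp
qed (simp add: mult_char_1 assms)

lemma mult_char_power_char:
  assumes "mult_char \<chi>"
  shows "mult_char (\<lambda>a. \<chi> a ^ t)"
  using assms by (auto simp: mult_char_def roots_of_unity_power power_mult_distrib)

lemma sum_mult_char_eq_0:
  assumes "mult_char (\<chi> :: 'a :: finite_field \<Rightarrow> complex)" "b \<noteq> 0" "\<chi> b \<noteq> 1"
  shows "(\<Sum>a\<in>UNIV - {0}. \<chi> a) = 0"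
proof -
  have "(\<Sum>a\<in>UNIV - {0}. \<chi> a) = (\<Sum>a\<in>UNIV - {0}. \<chi> (b * a))"
    by (rule sum.reindex_bij_witness[of _ "\<lambda>a. b * a" "\<lambda>a. a / b"]) (use assms in auto)
  also have "\<dots> = \<chi> b * (\<Sum>a\<in>UNIV - {0}. \<chi> a)"
    using assms by (simp add: mult_char_def sum_distrib_left)
  finally show ?thesis
    using assms(3) by simp
qed

text \<open>With \<open>n = CARD('a) - 1\<close>, the \<open>k\<close>-th power of
  \<open>\<chi>\<close> is trivial exactly when \<open>n\<close> divides \<open>m * k\<close>, and
  the least such \<open>k > 0\<close> is \<open>n / gcd m n\<close>.\<close>

lemma mult_char_order_gcd:
  fixes \<chi> :: "'a :: finite_field \<Rightarrow> complex"
  assumes \<chi>: "mult_char \<chi>" and g: "primitive_root (CARD('a) - 1) g"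
    and \<eta>: "primitive_root (CARD('a) - 1) \<eta>" and m: "\<chi> g = \<eta> ^ m"
    and order: "mult_char_order \<chi> = (CARD('a) - 1) div 2" and even: "even (CARD('a) - 1)"
  shows "gcd m (CARD('a) - 1) = 2"
proof -
  define n where "n = CARD('a) - 1"
  have n: "n > 0"
    using CARD_field_gt_1[where 'a = 'a] by (simp add: n_def)
  have g0: "g \<noteq> 0"
    using g n by (auto simp: primitive_root_def power_0_left n_def)
  have iff: "(\<forall>a. a \<noteq> 0 \<longrightarrow> \<chi> a ^ k = 1) \<longleftrightarrow> n dvd m * k" for k
  proof
    assume "\<forall>a. a \<noteq> 0 \<longrightarrow> \<chi> a ^ k = 1"
    then have "\<chi> g ^ k = 1"
      using g0 by blast
    then have "\<eta> ^ (m * k) = 1"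
      by (simp only: m power_mult)
    then show "n dvd m * k"
      using primitive_root_power_eq_1_iff[OF \<eta>] n by (simp add: n_def)
  next
    assume "n dvd m * k"
    then have *: "\<eta> ^ (m * k) = 1"
      using primitive_root_power_eq_1_iff[OF \<eta>] n by (simp add: n_def)
    show "\<forall>a. a \<noteq> 0 \<longrightarrow> \<chi> a ^ k = 1"
    proof (intro allI impI)
      fix a :: 'a assume "a \<noteq> 0"
      then obtain i where i: "a = g ^ i"
        using primitive_root_generates[OF g] by blast
      have "\<chi> a ^ k = (\<eta> ^ (m * k)) ^ i"
        by (simp add: i mult_char_power[OF \<chi> g0] m mult_ac flip: power_mult)
      with * show "\<chi> a ^ k = 1"
        by simp
    qed
  qed
  have L: "(LEAST k. k > 0 \<and> n dvd m * k) = n div 2"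
    using order by (simp add: mult_char_order_def iff n_def)
  have "n div 2 > 0 \<and> n dvd m * (n div 2)"
    unfolding L[symmetric] by (rule LeastI[of _ n]) (use n in simp)
  then have "2 * (n div 2) dvd m * (n div 2)" "n div 2 > 0"
    using even by (simp_all add: n_def)
  then have "2 dvd m"
    by simp
  then have 2: "2 dvd gcd m n"
    using even by (simp add: n_def)
  define d where "d = gcd m n"
  obtain r where r: "n = d * r"
    by (metis d_def gcd_dvd2 dvdE)
  have "n dvd m * r"
    by (metis d_def gcd_dvd1 mult_dvd_mono dvd_refl r)
  then have "n div 2 \<le> r"
    unfolding L[symmetric] using n r by (intro Least_le) auto
  then have "d * r \<le> 2 * r"
    using r even by (auto simp: n_def elim!: evenE)
  then have "d \<le> 2"
    using n r by simp
  moreover have "d > 0"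
    using n by (simp add: d_def)
  ultimately have "d = 2"
    using dvd_imp_le[OF 2[folded d_def]] by simp
  then show ?thesis
    by (simp add: d_def n_def)
qed

text \<open>Write \<open>m = 2 * a\<close> and \<open>n = 2 * r\<close>, solve
  \<open>a * t = - 1\<close> modulo \<open>r\<close>, and make \<open>t\<close> odd, hence coprime
  to \<open>n\<close>. The \<open>t\<close>-th power of a character with exponent \<open>m\<close>
  then has exponent -2.\<close>

lemma exists_twist:
  fixes m n :: nat
  assumes gcd: "gcd m n = 2" and "n > 0"
  obtains t where "coprime t n" "n dvd m * t + 2"
proof -
  have "2 dvd m" "2 dvd n"
    using gcd by (metis gcd_dvd1, metis gcd_dvd2)
  then obtain a r where ar: "m = 2 * a" "n = 2 * r"
    by (auto elim!: evenE)
  have r: "r > 0" "coprime a r"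
    using assms by (auto simp: ar gcd_mult_distrib_nat[symmetric] coprime_iff_gcd_eq_1)
  obtain x where x: "[a * x = 1] (mod r)"
    using cong_solve_coprime_nat[OF r(2)] by auto
  \<comment> \<open>The factor \<open>r - 1\<close> represents -1 modulo \<open>r\<close> in the
    natural numbers.\<close>
  define y where "y = x * (r - 1)"
  have "[a * x * (r - 1) + 1 = 1 * (r - 1) + 1] (mod r)"
    by (intro cong_add cong_mult x cong_refl)
  then have y: "r dvd a * y + 1"
    using r(1) by (simp add: y_def mult.assoc cong_def dvd_eq_mod_eq_0)
  \<comment> \<open>If \<open>y\<close> is even, \<open>r\<close> divides the odd number
    \<open>a * y + 1\<close> and is odd, so \<open>y + r\<close> is odd.\<close>
  define t where "t = (if odd y then y else y + r)"
  have t: "r dvd a * t + 1"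
    using y dvd_add[OF y, of "a * r"] by (simp add: t_def algebra_simps)
  have cop: "coprime t r"
  proof (rule coprimeI)
    fix c assume "c dvd t" "c dvd r"
    then have "c dvd a * t" "c dvd a * t + 1"
      using t by (auto intro: dvd_trans)
    then show "is_unit c"
      by (simp only: dvd_add_right_iff)
  qed
  have "odd t"
  proof (cases "odd y")
    case False
    have "odd r"
    proof
      assume "even r"
      then have "even (a * y + 1)"
        using y by (rule dvd_trans)
      with False show False
        by simp
    qed
    with False show ?thesis
      by (simp add: t_def)
  qed (simp add: t_def)
  with cop have "coprime t n"
    by (simp add: ar)
  moreover have "n dvd m * t + 2"
    using mult_dvd_mono[OF dvd_refl[of 2] t] by (simp add: ar algebra_simps)
  ultimately show ?thesis
    by (rule that)
qed

section \<open>Conjugating and comparing two Gauss sums\<close>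

text \<open>Conjugation by an exponent \<open>s\<close> that is 1 modulo \<open>p\<close> and
  \<open>t\<close> modulo \<open>CARD('a) - 1\<close> fixes the additive character and raises the
  multiplicative ones to the \<open>t\<close>-th power.\<close>

lemma gauss_sum_galois_conj:
  fixes \<chi> \<chi>' :: "'a :: finite_field \<Rightarrow> complex"
  assumes \<chi>: "mult_char \<chi>" "mult_char \<chi>'" and p: "p > 0" "coprime p (CARD('a) - 1)"
    and \<zeta>: "\<zeta> \<in> roots_of_unity p" and eq: "gauss_sum \<zeta> \<chi> = gauss_sum \<zeta> \<chi>'"
    and t: "coprime t (CARD('a) - 1)"
  shows "gauss_sum \<zeta> (\<lambda>a. \<chi> a ^ t) = gauss_sum \<zeta> (\<lambda>a. \<chi>' a ^ t)"
proof -
  define n where "n = CARD('a) - 1"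
  have n: "n > 0"
    using CARD_field_gt_1[where 'a = 'a] by (simp add: n_def)
  interpret cyclotomic "p * n"
    by unfold_locales (use p n in simp)
  obtain s where s: "[s = 1] (mod p)" "[s = t] (mod n)"
    using binary_chinese_remainder_nat[of p n 1 t] p by (auto simp: n_def)
  have "coprime s p" "coprime s n"
    using s t by (metis cong_imp_coprime cong_sym coprime_1_left, metis cong_imp_coprime cong_sym n_def)
  then have cop: "coprime s (p * n)"
    by simp
  define \<psi> where "\<psi> = (additive_char \<zeta> :: 'a \<Rightarrow> complex)"
  have \<psi>: "\<psi> a \<in> roots_of_unity p" for a
    unfolding \<psi>_def additive_char_def by (intro roots_of_unity_power \<zeta>)
  have red: "z ^ k = z ^ l" if "z \<in> roots_of_unity d" "[k = l] (mod d)" for z k l d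
  proof -
    have "z ^ k = z ^ (k mod d)" for k
    proof -
      have "z ^ k = z ^ (d * (k div d) + k mod d)"
        by simp
      also have "\<dots> = z ^ (k mod d)"
        using that(1) by (simp only: power_add power_mult) (simp add: roots_of_unity_def)
      finally show ?thesis .
    qed
    from this[of k] this[of l] that(2) show ?thesis
      by (simp add: cong_def)
  qed
  \<comment> \<open>The difference of the Gauss sums becomes one integer combination of roots of
    unity; the boolean tag selects the character and the sign.\<close>
  define S where "S = (UNIV - {0 :: 'a}) \<times> (UNIV :: bool set)"
  define r where "r = (\<lambda>(a, b). (if b then \<chi> a else \<chi>' a) * \<psi> a)"
  define c :: "'a \<times> bool \<Rightarrow> int" where "c = (\<lambda>(a, b). if b then 1 else - 1)"
  have sum_S: "(\<Sum>i\<in>S. of_int (c i) * h i) =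
      (\<Sum>a\<in>UNIV - {0}. h (a, True)) - (\<Sum>a\<in>UNIV - {0}. h (a, False))" for h :: "'a \<times> bool \<Rightarrow> complex"
  proof -
    have "(\<Sum>i\<in>S. of_int (c i) * h i) = (\<Sum>a\<in>UNIV - {0}. \<Sum>b\<in>UNIV. of_int (c (a, b)) * h (a, b))"
      by (simp add: S_def sum.cartesian_product)
    then show ?thesis
      by (simp add: c_def UNIV_bool sum_subtractf)
  qed
  have "(\<Sum>i\<in>S. of_int (c i) * r i) = 0"
    unfolding sum_S using eq by (simp add: r_def gauss_sum_def \<psi>_def)
  moreover have "r i \<in> roots_of_unity (p * n)" if iS: "i \<in> S" for i
  proof -
    obtain a b where i: "i = (a, b)" "a \<noteq> 0"
      using iS by (auto simp: S_def)
    have "\<chi> a \<in> roots_of_unity (p * n)" "\<chi>' a \<in> roots_of_unity (p * n)"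
      using mult_char_value(1)[OF \<chi>(1) i(2)] mult_char_value(1)[OF \<chi>(2) i(2)]
      by (simp_all add: n_def roots_of_unity_dvd[of _ "CARD('a) - 1"])
    moreover have "\<psi> a \<in> roots_of_unity (p * n)"
      using \<psi> by (rule roots_of_unity_dvd) simp
    ultimately show ?thesis
      by (simp add: i r_def roots_of_unity_mult)
  qed
  ultimately have "(\<Sum>i\<in>S. of_int (c i) * r i ^ s) = 0"
    using cop by (intro galois_conj) (auto simp: S_def)
  moreover have "r (a, b) ^ s = (if b then \<chi> a ^ t else \<chi>' a ^ t) * \<psi> a" if "a \<noteq> 0" for a b
    using red[OF \<psi> s(1), of a] red[OF mult_char_value(1)[OF \<chi>(1) that] s(2)[unfolded n_def]]
      red[OF mult_char_value(1)[OF \<chi>(2) that] s(2)[unfolded n_def]]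
    by (simp add: r_def power_mult_distrib)
  ultimately show ?thesis
    unfolding sum_S by (simp add: gauss_sum_def \<psi>_def)
qed

text \<open>With the exponent of \<open>\<chi>\<close> normalized to -2, twice the quadratic
  coefficient of the difference is the value at \<open>\<eta>\<close> of an integer polynomial. Its
  vanishing at \<open>g\<close> is a relation between trace moments, which the solution counts
  decide.\<close>

lemma gauss_sum_leading_coefficient:
  fixes \<chi> \<chi>' :: "'a :: finite_field \<Rightarrow> complex"
  assumes cyc: "cyclotomic_prime N p \<zeta>" and N: "N = p * (CARD('a) - 1)"
    and card: "CARD('a) = p ^ f" and f2: "f \<ge> 2"
    and \<eta>: "primitive_root (CARD('a) - 1) \<eta>"
    and g: "g \<noteq> 0" "\<And>P. ev P \<eta> \<in> cyc_ideal N (\<zeta> - 1) \<Longrightarrow> ev P g = 0"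
    and \<chi>: "mult_char \<chi>" "mult_char \<chi>'" and eq: "gauss_sum \<zeta> \<chi> = gauss_sum \<zeta> \<chi>'"
    and m: "\<chi> g = \<eta> ^ m" "CARD('a) - 1 dvd m + 2" and m': "\<chi>' g = \<eta> ^ m'"
  obtains i where "i < f" "CARD('a) - 1 dvd m' + 2 * p ^ i"
proof -
  interpret cyclotomic_prime N p \<zeta>
    by (rule cyc)
  define n where "n = CARD('a) - 1"
  have n: "n > 0"
    using CARD_field_gt_1[where 'a = 'a] by (simp add: n_def)
  interpret odd_prime_power p f
    by unfold_locales (use p f2 in simp_all)
  have char: "CHAR('a) = p"
    using CHAR_eq_of_CARD[OF p(1) card] .
  \<comment> \<open>This keeps \<open>n\<close> from dividing 2, so \<open>\<chi>\<close> is
    nontrivial.\<close>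
  have n4: "n \<ge> 4"
    using power_sum_le[of 0 1] f2 p_ge_3 by (simp add: n_def card)
  have N_n: "n dvd N" "p dvd N"
    by (simp_all add: N n_def)
  have \<eta>_A: "\<eta> \<in> A"
  proof (rule A_root, rule roots_of_unity_dvd)
    show "\<eta> \<in> roots_of_unity n"
      using \<eta> by (simp add: roots_of_unity_def primitive_root_def n_def)
  qed (rule N_n)
  have g_prim: "primitive_root (CARD('a) - 1) g"
    by (rule common_root_primitive[OF \<eta> g])
  \<comment> \<open>A discrete logarithm to base \<open>g\<close> for nonzero \<open>a\<close>; it
    writes all character values as powers of \<open>\<eta>\<close>.\<close>
  define E where "E a = (SOME i. a = g ^ i)" for a
  have E: "a = g ^ E a" if "a \<noteq> 0" for a
    unfolding E_def using primitive_root_generates[OF g_prim that] by (metis (mono_tags) someI)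
  have \<chi>_E: "\<chi> a = \<eta> ^ (m * E a)" "\<chi>' a = \<eta> ^ (m' * E a)" if "a \<noteq> 0" for a
    using E[OF that] mult_char_power[OF \<chi>(1) g(1), of "E a"] mult_char_power[OF \<chi>(2) g(1), of "E a"]
    by (simp_all add: m m' power_mult)
  define U where "U = UNIV - {0 :: 'a}"
  have U: "finite U"
    by (simp add: U_def)
  define t where "t a = prime_subfield_rep (field_trace a)" for a :: 'a
  have t: "of_nat (t a) = field_trace a" for a
    unfolding t_def by (rule prime_subfield_rep field_trace_in_prime_subfield)+
  have G: "gauss_sum \<zeta> \<theta> = (\<Sum>a\<in>U. \<theta> a * \<zeta> ^ t a)" for \<theta> :: "'a \<Rightarrow> complex"
    by (simp add: gauss_sum_def additive_char_def U_def t_def)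
  have root: "\<chi> a \<in> roots_of_unity N" "\<chi>' a \<in> roots_of_unity N" if "a \<in> U" for a
    using that mult_char_value(1)[OF \<chi>(1), of a] mult_char_value(1)[OF \<chi>(2), of a] N_n(1)
    by (simp_all add: U_def n_def roots_of_unity_dvd[of _ "CARD('a) - 1"])
  have root_A: "\<chi> a \<in> A" "\<chi>' a \<in> A" if "a \<in> U" for a
    by (intro A_root root that)+
  have sum_\<chi>: "(\<Sum>a\<in>U. \<chi> a) = 0"
  proof -
    have "\<not> n dvd m"
    proof
      assume "n dvd m"
      then have "n dvd 2"
        using m(2)[folded n_def] by (simp only: dvd_add_right_iff)
      then have "n \<le> 2"
        by (auto dest: dvd_imp_le)
      with n4 show False
        by simp
    qed
    then have "\<chi> g \<noteq> 1"
      using primitive_root_power_eq_1_iff[OF \<eta>] n by (simp add: m n_def)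
    then show ?thesis
      using sum_mult_char_eq_0[OF \<chi>(1) g(1)] by (simp add: U_def)
  qed
  \<comment> \<open>Modulo \<open>\<pi>\<close> the additive character is 1, so the constant term of
    a Gauss sum is the plain sum of the character.\<close>
  have congr: "(\<Sum>a\<in>U. \<theta> a * \<zeta> ^ t a) - (\<Sum>a\<in>U. \<theta> a) \<in> I \<pi>"
    if "\<And>a. a \<in> U \<Longrightarrow> \<theta> a \<in> A" for \<theta>
  proof -
    have "\<zeta> ^ k - 1 \<in> I \<pi>" for k
      using I_power_diff[of \<zeta> 1 \<pi> k] I_I[OF A_1, of \<pi>] \<zeta>_A A_1 by simp
    then have "(\<Sum>a\<in>U. \<theta> a * (\<zeta> ^ t a - 1)) \<in> I \<pi>"
      by (intro I_sum I_mult2 that)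
    then show ?thesis
      by (simp add: algebra_simps sum_subtractf)
  qed
  \<comment> \<open>For trivial \<open>\<chi>'\<close> the constant terms 0 and \<open>n\<close>
    would agree modulo \<open>\<pi>\<close>, but \<open>n = p ^ f - 1\<close> is -1 there.\<close>
  have "\<chi>' g \<noteq> 1"
  proof
    assume "\<chi>' g = 1"
    then have "\<chi>' a = 1" if "a \<in> U" for a
      using E[of a] mult_char_power[OF \<chi>(2) g(1), of "E a"] that by (simp add: U_def)
    then have "(\<Sum>a\<in>U. \<chi>' a) = of_nat n"
      by (simp add: U_def n_def card_Diff_subset)
    then have "(\<Sum>a\<in>U. \<chi> a * \<zeta> ^ t a) - of_nat n \<in> I \<pi>"
      using congr[of \<chi>'] root_A eq by (simp add: G)
    moreover have "(\<Sum>a\<in>U. \<chi> a * \<zeta> ^ t a) \<in> I \<pi>"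
      using congr[of \<chi>] root_A sum_\<chi> by simp
    ultimately have "(\<Sum>a\<in>U. \<chi> a * \<zeta> ^ t a) - ((\<Sum>a\<in>U. \<chi> a * \<zeta> ^ t a) - of_nat n) \<in> I \<pi>"
      by (rule I_diff[rotated])
    then have "of_nat n \<in> I \<pi>"
      by simp
    moreover have "of_nat (p ^ f) \<in> I \<pi>"
      using f p_in_I_\<pi> by (cases f) (auto intro: I_mult A_intros)
    ultimately have "of_nat (p ^ f) - of_nat n \<in> I \<pi>"
      by (intro I_diff)
    moreover have "p ^ f = n + 1"
      using n by (simp add: n_def card)
    ultimately show False
      using one_notin_I_\<pi> by simp
  qed
  then have sum_\<chi>': "(\<Sum>a\<in>U. \<chi>' a) = 0"
    using sum_mult_char_eq_0[OF \<chi>(2) g(1)] by (simp add: U_def)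
  \<comment> \<open>Character values are \<open>n\<close>-th roots of unity and
    \<open>p ^ f = n + 1\<close>, so this power fixes them.\<close>
  have frob_char: "(\<Sum>a\<in>U. of_int (c a) * \<theta> a) ^ (p ^ f) - (\<Sum>a\<in>U. of_int (c a) * \<theta> a) \<in> I (of_nat p)"
    if "mult_char \<theta>" for c and \<theta> :: "'a \<Rightarrow> complex"
  proof (intro frob_fixed_sum frob_fixed_int_mult_root A_mult A_of_int A_root p U)
    fix a assume "a \<in> U"
    then have a: "a \<noteq> 0"
      by (simp add: U_def)
    show "\<theta> a \<in> roots_of_unity N" "\<theta> a \<in> roots_of_unity N"
      using mult_char_value(1)[OF that a] N_n(1) unfolding n_def by (rule roots_of_unity_dvd)+
    have "p ^ f = Suc n"
      using n by (simp add: n_def card)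
    then have "\<theta> a ^ (p ^ f) = \<theta> a * \<theta> a ^ n"
      by (simp only: power_Suc)
    also have "\<theta> a ^ n = 1"
      unfolding n_def by (rule mult_char_value(2)[OF that a])
    finally show "\<theta> a ^ (p ^ f) = \<theta> a"
      by simp
  qed
  have D2: "(\<Sum>a\<in>U. (\<chi> a - \<chi>' a) * of_nat (t a choose 2)) \<in> I \<pi>"
  proof (rule second_coefficient)
    show "(\<Sum>a\<in>U. (\<chi> a - \<chi>' a) * \<zeta> ^ t a) = 0"
      using eq by (simp add: G left_diff_distrib sum_subtractf)
    show "(\<Sum>a\<in>U. \<chi> a - \<chi>' a) = 0"
      by (simp add: sum_subtractf sum_\<chi> sum_\<chi>')
    let ?q = "p ^ f"
    \<comment> \<open>The linear coefficient is split into one sum for each character, to which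
      \<open>frob_char\<close> applies.\<close>
    let ?x = "\<Sum>a\<in>U. of_int (int (t a)) * \<chi> a" and ?y = "\<Sum>a\<in>U. of_int (- int (t a)) * \<chi>' a"
    have "?x \<in> A" "?y \<in> A"
      by (intro A_sum A_mult A_of_int root_A; assumption)+
    then have "(?x + ?y) ^ ?q - (?x ^ ?q + ?y ^ ?q) \<in> I (of_nat p)"
      by (intro frob_add_power p)
    moreover have "(?x ^ ?q - ?x) + (?y ^ ?q - ?y) \<in> I (of_nat p)"
      by (intro I_add frob_char \<chi>)
    then have "(?x ^ ?q + ?y ^ ?q) - (?x + ?y) \<in> I (of_nat p)"
      by (simp only: diff_add_eq add_diff_eq diff_diff_eq2 diff_diff_eq add_ac)
    ultimately have "(?x + ?y) ^ ?q - (?x + ?y) \<in> I (of_nat p)"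
      by (rule I_diff_trans)
    moreover have "?x + ?y = (\<Sum>a\<in>U. (\<chi> a - \<chi>' a) * of_nat (t a))"
      unfolding sum.distrib[symmetric] by (intro sum.cong) (auto simp: algebra_simps)
    ultimately show "(\<Sum>a\<in>U. (\<chi> a - \<chi>' a) * of_nat (t a)) ^ ?q -
        (\<Sum>a\<in>U. (\<chi> a - \<chi>' a) * of_nat (t a)) \<in> I (of_nat p)"
      by (simp only:)
  qed (use U f root_A in \<open>auto intro: A_diff\<close>)
  \<comment> \<open>Doubling the binomial coefficient avoids a division; in the field
    \<open>c a\<close> becomes \<open>field_trace a * (field_trace a - 1)\<close>.\<close>
  define c where "c a = int (t a) * (int (t a) - 1)" for a
  have c: "c a = 2 * int (t a choose 2)" for a
  proof -
    have "even (t a * (t a - 1))"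
      by (cases "t a") auto
    then have "2 * (t a choose 2) = t a * (t a - 1)"
      unfolding choose_two by (rule dvd_mult_div_cancel)
    then have "2 * int (t a choose 2) = int (t a * (t a - 1))"
      by (metis of_nat_mult of_nat_numeral)
    then show ?thesis
      by (cases "t a") (simp_all add: c_def algebra_simps)
  qed
  define F where "F = (\<Sum>a\<in>U. monom (c a) (m * E a) - monom (c a) (m' * E a))"
  have "ev F \<eta> = (\<Sum>a\<in>U. of_int (c a) * (\<chi> a - \<chi>' a))"
    unfolding F_def ev_sum ev_diff ev_monom
    by (intro sum.cong) (auto simp: U_def \<chi>_E algebra_simps)
  also have "\<dots> = of_nat 2 * (\<Sum>a\<in>U. (\<chi> a - \<chi>' a) * of_nat (t a choose 2))"
    unfolding sum_distrib_left by (intro sum.cong) (auto simp: c)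
  also have "\<dots> \<in> I \<pi>"
    by (intro I_mult2 D2 A_of_nat)
  finally have "ev F g = 0"
    by (rule g)
  also have "ev F g = (\<Sum>a\<in>U. of_int (c a) * (g ^ (m * E a) - g ^ (m' * E a)))"
    by (simp add: F_def ev_sum ev_diff ev_monom algebra_simps)
  also have "\<dots> = (\<Sum>a\<in>U. field_trace a * (field_trace a - 1) * (a ^ m - a ^ m'))"
  proof (intro sum.cong refl arg_cong2[of _ _ _ _ "(*)"])
    fix a assume "a \<in> U"
    then have a: "a = g ^ E a"
      by (intro E) (simp add: U_def)
    have "a ^ k = g ^ (k * E a)" for k
      by (subst a) (simp add: mult.commute flip: power_mult)
    then show "g ^ (m * E a) - g ^ (m' * E a) = a ^ m - a ^ m'"
      by simp
  qed (simp add: c_def flip: t)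
  also have "\<dots> = (\<Sum>a\<in>U. a ^ m * (field_trace a * (field_trace a - 1))) -
      (\<Sum>a\<in>U. a ^ m' * (field_trace a * (field_trace a - 1)))"
    by (simp add: algebra_simps sum_subtractf sum.distrib)
  also have "\<dots> = of_nat (card (single_sols p f m)) - of_nat (card (pair_sols p f m)) -
      (of_nat (card (single_sols p f m')) - of_nat (card (pair_sols p f m')))"
  proof -
    have "field_trace a = (\<Sum>i<f. a ^ (p ^ i))" for a :: 'a
      using field_trace_eq[of f g a] card g(1) primitive_root_generates[OF g_prim] by (metis char)
    from trace_moment[OF card this] show ?thesis
      by (simp only: U_def)
  qed
  \<comment> \<open>For \<open>m\<close> there is one pair and no single solution, so its moment is
    -1, and the moment for \<open>m'\<close> must equal it.\<close>
  finally have "of_nat (card (single_sols p f m')) - of_nat (card (pair_sols p f m')) = (- 1 :: 'a)"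
    using sols_count_minus_2[of m] m(2) by (simp add: card)
  then have "- (of_nat (card (single_sols p f m')) - of_nat (card (pair_sols p f m'))) - 1 = (0 :: 'a)"
    by (simp only: minus_minus diff_self)
  then have "of_int (int (card (pair_sols p f m')) - int (card (single_sols p f m')) - 1) = (0 :: 'a)"
    by simp
  then have "[int (card (pair_sols p f m')) - int (card (single_sols p f m')) = 1] (mod int p)"
    unfolding of_int_eq_0_iff_char_dvd char cong_iff_dvd_diff .
  then obtain i where "i < f" "p ^ f - 1 dvd m' + 2 * p ^ i"
    by (rule sols_count_cong_1)
  then show ?thesis
    by (intro that[of i]) (simp_all add: card)
qed

section \<open>From the twisted characters back to \<open>\<chi>\<close> and
  \<open>\<chi>'\<close>\<close>

theorem corollary3p8:
  fixes p f q :: nat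
    and \<zeta> :: complex
    and \<chi> \<chi>' :: "'a :: finite_field \<Rightarrow> complex"
  assumes "prime p" and "odd p" and "f \<ge> 2" and "q = p ^ f" and "CARD('a) = q"
    and "\<zeta> \<in> roots_of_unity p" and "roots_of_unity p = range (\<lambda>k :: nat. \<zeta> ^ k)"
    and "mult_char \<chi>" and "mult_char \<chi>'"
    and "mult_char_order \<chi> = (q - 1) div 2"
    and "gauss_sum \<zeta> \<chi> = gauss_sum \<zeta> \<chi>'"
  shows "frobenius_conjugate \<chi> \<chi>'"
proof -
  note p = assms(1,2) and f = assms(3) and \<chi> = assms(8,9)
  have card: "CARD('a) = p ^ f"
    using assms by simp
  have char: "CHAR('a) = p"
    using CHAR_eq_of_CARD[OF p(1) card] .
  define n where "n = CARD('a) - 1"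
  have n: "n > 0"
    using CARD_field_gt_1[where 'a = 'a] by (simp add: n_def)
  have p0: "p > 0"
    using p(1) by (simp add: prime_gt_0_nat)
  have "\<zeta> \<noteq> 1"
  proof
    assume "\<zeta> = 1"
    then have "roots_of_unity p = {1}"
      using assms(7) by auto
    then show False
      using card_roots_of_unity[OF p0] prime_gt_1_nat[OF p(1)] by simp
  qed
  then have cyc: "cyclotomic_prime (p * n) p \<zeta>"
    using p p0 n assms(6) by unfold_locales (auto simp: roots_of_unity_def)
  then interpret cyclotomic_prime "p * n" p \<zeta> .
  obtain \<eta> where \<eta>: "primitive_root n \<eta>" "roots_of_unity n = range (\<lambda>k. \<eta> ^ k)"
    using complex_primitive_root[OF n] .
  have \<eta>_A: "\<eta> \<in> A"
    using \<eta>(1) by (intro A_root) (simp add: roots_of_unity_def power_mult primitive_root_def mult.commute[of p])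
  have \<eta>_n: "\<eta> ^ (CARD('a) - 1) = 1"
    using \<eta>(1) by (simp add: primitive_root_def n_def)
  have CHAR_in_I: "of_nat CHAR('a) \<in> I \<pi>"
    unfolding char by (rule p_in_I_\<pi>)
  obtain g :: 'a where g: "g \<noteq> 0" "\<And>P. ev P \<eta> \<in> I \<pi> \<Longrightarrow> ev P g = 0"
    using common_root[where 'a = 'a, OF \<eta>_A \<eta>_n CHAR_in_I one_notin_I_\<pi>] by blast
  have g_prim: "primitive_root n g"
    unfolding n_def by (rule common_root_primitive[OF \<eta>(1)[unfolded n_def] g])
  obtain m m' where m: "\<chi> g = \<eta> ^ m" "\<chi>' g = \<eta> ^ m'"
    using mult_char_value(1)[OF \<chi>(1) g(1)] mult_char_value(1)[OF \<chi>(2) g(1)] \<eta>(2)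
    by (auto simp: n_def)
  have "even n"
    using p by (simp add: n_def card)
  then have "gcd m n = 2"
    using mult_char_order_gcd[OF \<chi>(1) g_prim[unfolded n_def] \<eta>(1)[unfolded n_def] m(1)] assms(4,5,10)
    by (simp add: n_def)
  \<comment> \<open>Passing to \<open>t\<close>-th powers turns the exponent \<open>m\<close> into
    -2 modulo \<open>n\<close>; coprimality allows \<open>t\<close> to be cancelled at the
    end.\<close>
  then obtain t where t: "coprime t n" "n dvd m * t + 2"
    using exists_twist n by blast
  have "coprime p n"
  proof (rule prime_imp_coprime[OF p(1)])
    have "p dvd p ^ f"
      using f by simp
    moreover have "p ^ f = n + 1"
      using n by (simp add: n_def card)
    ultimately show "\<not> p dvd n"
      using p(1) by (metis dvd_add_right_iff not_prime_unit)
  qed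
  then have eq: "gauss_sum \<zeta> (\<lambda>a. \<chi> a ^ t) = gauss_sum \<zeta> (\<lambda>a. \<chi>' a ^ t)"
    using gauss_sum_galois_conj[OF \<chi> p0 _ assms(6,11)] t(1) by (simp add: n_def)
  obtain i where i: "i < f" "n dvd m' * t + 2 * p ^ i"
    using gauss_sum_leading_coefficient[OF cyc[unfolded n_def] refl card f \<eta>(1)[unfolded n_def]
        g[unfolded n_def] \<chi>[THEN mult_char_power_char, of t] eq, of "m * t" "m' * t"] t(2)
    by (auto simp: m n_def power_mult)
  \<comment> \<open>Both \<open>m' * t\<close> and \<open>m * t * p ^ i\<close> are
    \<open>- 2 * p ^ i\<close> modulo \<open>n\<close>.\<close>
  have "n dvd (m * t + 2) * p ^ i"
    using t(2) by (rule dvd_mult2)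
  then have "n dvd m * t * p ^ i + 2 * p ^ i"
    by (simp only: distrib_right)
  then have "[m' * t + 2 * p ^ i = m * t * p ^ i + 2 * p ^ i] (mod n)"
    using i(2) unfolding cong_def dvd_eq_mod_eq_0 by (simp only:)
  then have "[m' * t = m * p ^ i * t] (mod n)"
    by (simp add: cong_add_rcancel_nat mult_ac)
  then have mm': "[m' = m * p ^ i] (mod n)"
    using t(1) by (simp add: cong_mult_rcancel_nat)
  have "\<chi>' a = \<chi> (a ^ (p ^ i))" if "a \<noteq> 0" for a
  proof -
    obtain e where e: "a = g ^ e"
      using primitive_root_generates[OF g_prim[unfolded n_def] \<open>a \<noteq> 0\<close>] .
    have "\<chi>' a = (\<eta> ^ m') ^ e"
      by (simp add: e mult_char_power[OF \<chi>(2) g(1)] m)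
    also have "\<eta> ^ m' = \<eta> ^ (m * p ^ i)"
      using mm' primitive_root_power_eq_iff[OF \<eta>(1) n] by simp
    also have "\<dots> = \<chi> g ^ (p ^ i)"
      by (simp add: m power_mult)
    also have "\<dots> ^ e = \<chi> (a ^ (p ^ i))"
      by (simp add: e mult_char_power[OF \<chi>(1)] g(1) mult.commute flip: power_mult)
    finally show ?thesis .
  qed
  moreover have "(\<lambda>a :: 'a. a ^ (p ^ i)) \<in> galois_group"
    using frobenius_power_in_galois_group[where 'a = 'a and k = i] by (simp only: char)
  ultimately show ?thesis
    unfolding frobenius_conjugate_def by (intro bexI[of _ "\<lambda>a. a ^ (p ^ i)"]) auto
qed

end
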